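(* Let $M_G$ be an $n$-vertex mixed graph. Then $\rho(M_G)<\sqrt3$ if and only if every connected component of $M_G$ is switching equivalent to one of $P_1,P_2,P_3,P_4$ or $C_4^{=}$.
   Context: A mixed graph $M_G$ is obtained from a finite simple graph $G$ by orienting the edges of some subset of $E(G)$. With $\omega=\frac{1+\mathbf{i}\sqrt3}{2}$, $N(M_G)$ has $(u,v)$-entry $\omega$ if $\overrightarrow{uv}$ is an arc, $\bar\omega$ if $\overrightarrow{vu}$ is an arc, $1$ for an undirected edge, $0$ otherwise; $\rho(M_G)$ is the maximum absolute value of an eigenvalue of $N(M_G)$. $P_k$ is the undirected path on $k$ vertices; $C_4^{=}$ is the mixed $4$-cycle $v_1v_2v_3v_4v_1$ with arcs $\overrightarrow{v_1v_2},\overrightarrow{v_2v_3},\overrightarrow{v_3v_4}$ and undirected edge $\{v_4,v_1\}$. Switching: $\mathbb{T}_6=\{1,-1,\omega,\bar\omega,-\omega,-\bar\omega\}$; given a partition $V=\bigcup_{j\in\mathbb{T}_6}V_j$ into possibly empty sets, an edge or arc $xy$ has type $(j,k)$ if $x\in V_j,y\in V_k$ (arcs directed from $x$ to $y$); the partition is admissible if every undirected edge has type $(j,j)$ or $(j,\omega j)$ and every arc has type $(j,j)$, $(j,\bar\omega j)$ or $(j,-\omega j)$ for some $j$; a three-way switching replaces each undirected edge of type $(j,\omega j)$ by an arc from $V_j$ to $V_{\omega j}$, each arc of type $(j,\bar\omega j)$ by an undirected edge, and reverses each arc of type $(j,-\omega j)$. Two mixed graphs are switching equivalent if one is obtained from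 the other (up to isomorphism) by a sequence of three-way switchings and reversals of all arcs. *)

theory Defs
  imports Complex_Main
begin

record 'a mgraph =
  verts :: "'a set"
  edges :: "'a set set"
  arcs  :: "('a \<times> 'a) set"

definition mixed_graph :: "'a mgraph \<Rightarrow> bool" where
  "mixed_graph G \<longleftrightarrow>
     finite (verts G) \<and>
     (\<forall>e\<in>edges G. \<exists>u v. e = {u, v} \<and> u \<noteq> v \<and> u \<in> verts G \<and> v \<in> verts G) \<and>
     (\<forall>(u, v)\<in>arcs G. u \<noteq> v \<and> u \<in> verts G \<and> v \<in> verts G) \<and>
     (\<forall>(u, v)\<in>arcs G. (v, u) \<notin> arcs G \<and> {u, v} \<notin> edges G)"

definition omega :: complex where
  "omega = Complex (1/2) (sqrt 3 / 2)"

definition Nmat :: "'a mgraph \<Rightarrow> 'a \<Rightarrow> 'a \<Rightarrow> complex" where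
  "Nmat G u v =
     (if (u, v) \<in> arcs G then omega
      else if (v, u) \<in> arcs G then cnj omega
      else if {u, v} \<in> edges G then 1 else 0)"

definition is_eigenvalue :: "'a mgraph \<Rightarrow> complex \<Rightarrow> bool" where
  "is_eigenvalue G lam \<longleftrightarrow>
     (\<exists>x :: 'a \<Rightarrow> complex. (\<exists>v\<in>verts G. x v \<noteq> 0) \<and>
        (\<forall>u\<in>verts G. (\<Sum>v\<in>verts G. Nmat G u v * x v) = lam * x u))"

definition spectral_radius :: "'a mgraph \<Rightarrow> real" where
  "spectral_radius G = Max (cmod ` {lam. is_eigenvalue G lam})"

definition adj :: "'a mgraph \<Rightarrow> 'a \<Rightarrow> 'a \<Rightarrow> bool" where
  "adj G u v \<longleftrightarrow> {u, v} \<in> edges G \<or> (u, v) \<in> arcs G \<or> (v, u) \<in> arcs G"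

definition components :: "'a mgraph \<Rightarrow> 'a set set" where
  "components G = {{v \<in> verts G. (adj G)\<^sup>*\<^sup>* u v} | u. u \<in> verts G}"

definition induced :: "'a mgraph \<Rightarrow> 'a set \<Rightarrow> 'a mgraph" where
  "induced G C = \<lparr>verts = C, edges = {e \<in> edges G. e \<subseteq> C},
                   arcs = {(u, v) \<in> arcs G. u \<in> C \<and> v \<in> C}\<rparr>"

definition mg_iso :: "'a mgraph \<Rightarrow> 'b mgraph \<Rightarrow> bool" where
  "mg_iso G H \<longleftrightarrow> (\<exists>h. bij_betw h (verts G) (verts H) \<and>
     edges H = (\<lambda>e. h ` e) ` edges G \<and>
     arcs H = (\<lambda>(u, v). (h u, h v)) ` arcs G)"

text \<open>Three-way switching. The partition V = union of V_j, j in T6, is given by a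
  labelling f with f v in T6 (v in V_j iff f v = j).\<close>
definition T6 :: "complex set" where
  "T6 = {1, -1, omega, cnj omega, - omega, - cnj omega}"

definition admissible :: "'a mgraph \<Rightarrow> ('a \<Rightarrow> complex) \<Rightarrow> bool" where
  "admissible G f \<longleftrightarrow>
     (\<forall>v\<in>verts G. f v \<in> T6) \<and>
     (\<forall>x y. {x, y} \<in> edges G \<longrightarrow> f y = f x \<or> f y = omega * f x \<or> f x = omega * f y) \<and>
     (\<forall>(x, y)\<in>arcs G. f y = f x \<or> f y = cnj omega * f x \<or> f y = - omega * f x)"

definition three_way_switch :: "'a mgraph \<Rightarrow> ('a \<Rightarrow> complex) \<Rightarrow> 'a mgraph" where
  "three_way_switch G f =
     \<lparr>verts = verts G,
      edges = {{x, y} | x y. {x, y} \<in> edges G \<and> f y = f x}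
              \<union> {{x, y} | x y. (x, y) \<in> arcs G \<and> f y = cnj omega * f x},
      arcs = {(x, y). (x, y) \<in> arcs G \<and> f y = f x}
              \<union> {(x, y). {x, y} \<in> edges G \<and> f y = omega * f x}
              \<union> {(y, x) | x y. (x, y) \<in> arcs G \<and> f y = - omega * f x}\<rparr>"

definition reverse_arcs :: "'a mgraph \<Rightarrow> 'a mgraph" where
  "reverse_arcs G = G\<lparr>arcs := (\<lambda>(u, v). (v, u)) ` arcs G\<rparr>"

definition switch_step :: "'a mgraph \<Rightarrow> 'a mgraph \<Rightarrow> bool" where
  "switch_step G H \<longleftrightarrow>
     (\<exists>f. admissible G f \<and> H = three_way_switch G f) \<or> H = reverse_arcs G"

definition switching_equivalent :: "'a mgraph \<Rightarrow> 'b mgraph \<Rightarrow> bool" where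
  "switching_equivalent G H \<longleftrightarrow>
     (\<exists>G'. switch_step\<^sup>*\<^sup>* G G' \<and> mg_iso G' H) \<or>
     (\<exists>H'. switch_step\<^sup>*\<^sup>* H H' \<and> mg_iso H' G)"

definition path_mg :: "nat \<Rightarrow> nat mgraph" where
  "path_mg k = \<lparr>verts = {0..<k}, edges = {{i, Suc i} | i. Suc i < k}, arcs = {}\<rparr>"

definition C4eq :: "nat mgraph" where
  "C4eq = \<lparr>verts = {0, 1, 2, 3}, edges = {{3, 0}}, arcs = {(0, 1), (1, 2), (2, 3)}\<rparr>"

end

theory Submission
  imports "HOL-Analysis.Function_Topology" "HOL-Analysis.Topology_Euclidean_Space"
    "Jordan_Normal_Form.Char_Poly" Defs
begin

text \<open>Since N is Hermitian, the spectral radius is below sqrt 3 iff |Nx|^2 < 3 |x|^2 for every nonzero x.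
  This property is invariant under switching, because a switching conjugates N by a unitary diagonal
  matrix, and it passes to induced subgraphs. Test vectors therefore exclude vertices of degree 3,
  paths with 5 vertices, triangles, and 4-cycles whose weight (the product of the entries of N around
  the cycle) is not -1. What remains in a component is a path without chord, which one switching makes
  undirected, or a 4-cycle of weight -1. The weights being 1, omega and cnj omega, the latter must
  have three arcs in a row in the same direction and one undirected edge.\<close>

section \<open>Spectral radius and the quadratic form\<close>

text \<open>The quadratic form is preferred to eigenvalues because a test vector on a few vertices
  extends by zero to the whole graph, so no interlacing is required. The price is the converse
  passage from a bound on eigenvalues to a bound on the form, paid by a compactness argument. The
  obstacle is the lack of slack: a star with three leaves, a path with five vertices and a 4-cycle
  of weight \<open>- omega\<close> or \<open>- cnj omega\<close> all have spectral radius exactly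
  sqrt 3. Their test vectors must therefore reach the factor 3, and every inequality has to be
  strict. A second difficulty is that the vertices of a path in the graph may carry further edges.
  The degree bound comes first for this reason: it leaves at most one extra edge, joining the two
  ends, and after a choice of phases the matrix on the path has a single unknown entry w. The tests
  on paths with five, three and four vertices only have to deal with w.\<close>

lemma omega_sixth_root:
  "cmod omega = 1" "omega * cnj omega = 1" "cnj omega * omega = 1" "omega \<noteq> 0"
  by (simp_all add: omega_def complex_eq_iff cmod_def power2_eq_square)

lemma omega_square: "omega * omega = - cnj omega" "cnj omega * cnj omega = - omega"
  by (simp_all add: omega_def complex_eq_iff)

lemma Nmat_hermitian: "mixed_graph G \<Longrightarrow> Nmat G v u = cnj (Nmat G u v)"
  unfolding Nmat_def mixed_graph_def by (auto simp: insert_commute)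

lemma Nmat_eq_0_iff: "Nmat G u v = 0 \<longleftrightarrow> \<not> adj G u v"
  by (auto simp: Nmat_def adj_def omega_sixth_root)

lemma cmod_Nmat: "cmod (Nmat G u v) = (if adj G u v then 1 else 0)"
  by (auto simp: Nmat_def adj_def omega_sixth_root)

section \<open>The Hermitian form and its adjointness\<close>

definition mat_app :: "'a mgraph \<Rightarrow> ('a \<Rightarrow> complex) \<Rightarrow> 'a \<Rightarrow> complex" where
  "mat_app G x u = (\<Sum>v\<in>verts G. Nmat G u v * x v)"

definition sqnorm :: "'a set \<Rightarrow> ('a \<Rightarrow> complex) \<Rightarrow> real" where
  "sqnorm V x = (\<Sum>v\<in>V. (cmod (x v))\<^sup>2)"

definition subcritical :: "'a mgraph \<Rightarrow> bool" where
  "subcritical G \<longleftrightarrow>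
     (\<forall>x. (\<exists>v\<in>verts G. x v \<noteq> 0) \<longrightarrow> sqnorm (verts G) (mat_app G x) < 3 * sqnorm (verts G) x)"

lemma sqnorm_nonneg: "sqnorm V x \<ge> 0"
  by (simp add: sqnorm_def sum_nonneg)

lemma sqnorm_eq_0_iff: "finite V \<Longrightarrow> sqnorm V x = 0 \<longleftrightarrow> (\<forall>v\<in>V. x v = 0)"
  by (simp add: sqnorm_def sum_nonneg_eq_0_iff)

lemma sqnorm_pos_iff: "finite V \<Longrightarrow> sqnorm V x > 0 \<longleftrightarrow> (\<exists>v\<in>V. x v \<noteq> 0)"
  by (metis sqnorm_eq_0_iff sqnorm_nonneg less_eq_real_def order_less_irrefl)

lemma sqnorm_cong: "(\<And>v. v \<in> V \<Longrightarrow> cmod (x v) = cmod (y v)) \<Longrightarrow> sqnorm V x = sqnorm V y"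
  by (simp add: sqnorm_def)

lemma mat_app_cong: "(\<And>v. v \<in> verts G \<Longrightarrow> x v = y v) \<Longrightarrow> mat_app G x = mat_app G y"
  by (simp add: mat_app_def fun_eq_iff)

lemma sqnorm_scale: "sqnorm V (\<lambda>v. c * x v) = (cmod c)\<^sup>2 * sqnorm V x"
  by (simp add: sqnorm_def norm_mult power_mult_distrib sum_distrib_left)

lemma mat_app_scale: "mat_app G (\<lambda>v. c * x v) u = c * mat_app G x u"
  by (simp add: mat_app_def sum_distrib_left mult.left_commute)

lemma mat_app_add: "mat_app G (\<lambda>v. x v + y v) u = mat_app G x u + mat_app G y u"
  by (simp add: mat_app_def sum.distrib algebra_simps)

lemma mat_app_self_adjoint:
  assumes "mixed_graph G"
  shows "(\<Sum>u\<in>verts G. mat_app G x u * cnj (y u)) = (\<Sum>u\<in>verts G. x u * cnj (mat_app G y u))"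
proof -
  have "(\<Sum>u\<in>verts G. mat_app G x u * cnj (y u))
      = (\<Sum>u\<in>verts G. \<Sum>v\<in>verts G. Nmat G u v * x v * cnj (y u))"
    by (simp add: mat_app_def sum_distrib_right)
  also have "\<dots> = (\<Sum>v\<in>verts G. \<Sum>u\<in>verts G. Nmat G u v * x v * cnj (y u))"
    by (rule sum.swap)
  also have "\<dots> = (\<Sum>v\<in>verts G. \<Sum>u\<in>verts G. x v * cnj (Nmat G v u * y u))"
    by (intro sum.cong refl, subst Nmat_hermitian[OF assms]) (simp add: mult_ac)
  finally show ?thesis by (simp add: mat_app_def sum_distrib_left)
qed

lemma sqnorm_diff_scaled:
  fixes c :: real
  shows "sqnorm V (\<lambda>v. a v - of_real c * b v) =
    sqnorm V a - 2 * c * Re (\<Sum>v\<in>V. a v * cnj (b v)) + c\<^sup>2 * sqnorm V b"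
proof -
  have "(cmod (a v - of_real c * b v))\<^sup>2 =
      (cmod (a v))\<^sup>2 - 2 * c * Re (a v * cnj (b v)) + c\<^sup>2 * (cmod (b v))\<^sup>2" for v
    by (simp only: cmod_power2) (simp add: power2_eq_square algebra_simps)
  then show ?thesis
    by (simp only: sqnorm_def sum.distrib sum_subtractf sum_distrib_left Re_sum)
qed

text \<open>Tychonoff: each coordinate ranges over a compact set, the unit disc or {0}. The type
  \<open>'a\<close> may be infinite, so the unit ball of functions on the vertices is modelled by
  functions that vanish elsewhere.\<close>

lemma compact_coordinate_box:
  "compact {x :: 'a \<Rightarrow> complex. (\<forall>v\<in>V. cmod (x v) \<le> 1) \<and> (\<forall>v. v \<notin> V \<longrightarrow> x v = 0)}"
proof -
  let ?B = "\<lambda>v. if v \<in> V then cball 0 1 else {0 :: complex}"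
  have "compactin (product_topology (\<lambda>_. euclidean) UNIV) (Pi\<^sub>E UNIV ?B)"
    by (subst compactin_PiE) simp
  moreover have "Pi\<^sub>E UNIV ?B = {x. (\<forall>v\<in>V. cmod (x v) \<le> 1) \<and> (\<forall>v. v \<notin> V \<longrightarrow> x v = 0)}"
    by (auto simp: PiE_def Pi_def split: if_splits)
  ultimately show ?thesis
    by (simp add: euclidean_product_topology)
qed

lemma continuous_sqnorm:
  "(\<And>v. v \<in> V \<Longrightarrow> continuous_on S (\<lambda>x. f x v)) \<Longrightarrow> continuous_on S (\<lambda>x. sqnorm V (f x))"
  unfolding sqnorm_def by (intro continuous_intros)

lemma continuous_coordinate: "continuous_on S (\<lambda>x :: 'a \<Rightarrow> complex. x v)"
  by (rule continuous_on_subset[OF continuous_on_product_coordinates subset_UNIV])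

lemma sqnorm_maximiser:
  fixes G :: "'a mgraph"
  assumes "finite (verts G)" "verts G \<noteq> {}"
  obtains x where "sqnorm (verts G) x = 1"
    "\<And>y. sqnorm (verts G) (mat_app G y) \<le> sqnorm (verts G) (mat_app G x) * sqnorm (verts G) y"
proof -
  let ?V = "verts G"
  define K where "K = {x :: 'a \<Rightarrow> complex. (\<forall>v\<in>?V. cmod (x v) \<le> 1) \<and> (\<forall>v. v \<notin> ?V \<longrightarrow> x v = 0)}
    \<inter> {x. sqnorm ?V x = 1}"
  have "closed {x :: 'a \<Rightarrow> complex. sqnorm ?V x = 1}"
    by (rule closed_Collect_eq[OF continuous_sqnorm[of ?V UNIV "\<lambda>x. x"] continuous_on_const])
      (rule continuous_coordinate)
  then have "compact K"
    unfolding K_def by (intro compact_Int_closed compact_coordinate_box)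
  moreover from assms obtain w where "w \<in> ?V" by blast
  then have "(\<lambda>v. if v = w then 1 else 0) \<in> K"
    using assms by (auto simp: K_def sqnorm_def if_distrib if_distribR sum.delta cong: if_cong)
  then have "K \<noteq> {}" by blast
  moreover have "continuous_on K (\<lambda>x. sqnorm ?V (mat_app G x))"
    by (rule continuous_sqnorm)
      (auto simp: mat_app_def intro!: continuous_intros continuous_coordinate)
  ultimately obtain x where x: "x \<in> K"
    "\<And>y. y \<in> K \<Longrightarrow> sqnorm ?V (mat_app G y) \<le> sqnorm ?V (mat_app G x)"
    using continuous_attains_sup[of K "\<lambda>x. sqnorm ?V (mat_app G x)"] by blast
  have "sqnorm ?V (mat_app G y) \<le> sqnorm ?V (mat_app G x) * sqnorm ?V y" for y
  proof (cases "sqnorm ?V y = 0")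
    case True
    then have "mat_app G y = (\<lambda>_. 0)"
      using assms by (simp add: sqnorm_eq_0_iff mat_app_def fun_eq_iff)
    then show ?thesis using True by (simp add: sqnorm_def)
  next
    case False
    define c where "c = 1 / sqrt (sqnorm ?V y)"
    have c: "c\<^sup>2 * sqnorm ?V y = 1"
      using False sqnorm_nonneg[of ?V y] by (simp add: c_def power_divide)
    \<comment> \<open>The scaled vector is cut off outside the vertices because \<open>K\<close>
      demands it; \<open>mat_app\<close> does not see the difference.\<close>
    define z where "z v = (if v \<in> ?V then of_real c * y v else 0)" for v
    have z1: "sqnorm ?V z = 1"
      using c sqnorm_scale[of ?V "of_real c" y] sqnorm_cong[of ?V z "\<lambda>v. of_real c * y v"]
      by (simp add: z_def)
    have "cmod (z v) \<le> 1" if "v \<in> ?V" for v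
    proof -
      have "(cmod (z v))\<^sup>2 \<le> sqnorm ?V z"
        unfolding sqnorm_def by (rule member_le_sum) (use that assms in auto)
      then show ?thesis using z1 by (simp add: abs_square_le_1)
    qed
    then have "z \<in> K" using z1 by (simp add: K_def z_def)
    then have "sqnorm ?V (mat_app G z) \<le> sqnorm ?V (mat_app G x)" by (rule x)
    moreover have "mat_app G z = mat_app G (\<lambda>v. of_real c * y v)"
      by (rule mat_app_cong) (simp add: z_def)
    then have "sqnorm ?V (mat_app G z) = c\<^sup>2 * sqnorm ?V (mat_app G y)"
      by (simp add: mat_app_scale[abs_def] sqnorm_scale)
    ultimately have "c\<^sup>2 * sqnorm ?V (mat_app G y) * sqnorm ?V y \<le> sqnorm ?V (mat_app G x) * sqnorm ?V y"
      by (simp only: mult_right_mono sqnorm_nonneg)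
    moreover have "c\<^sup>2 * sqnorm ?V (mat_app G y) * sqnorm ?V y = sqnorm ?V (mat_app G y)"
      by (metis c mult.assoc mult.commute mult.right_neutral)
    ultimately show ?thesis by simp
  qed
  moreover have "sqnorm ?V x = 1" using x(1) by (simp add: K_def)
  ultimately show thesis using that by blast
qed

text \<open>A maximiser x of |Nx| on the unit sphere satisfies N(Nx) = mu x with mu = |Nx|^2, because
  |N(Nx) - mu x|^2 is at most mu^2 - 2 mu^2 + mu^2; so one of sqrt mu, - sqrt mu is an eigenvalue.\<close>
lemma dominant_eigenvalue:
  assumes "mixed_graph G" "verts G \<noteq> {}"
  obtains l where "is_eigenvalue G l"
    "\<And>y. sqnorm (verts G) (mat_app G y) \<le> (cmod l)\<^sup>2 * sqnorm (verts G) y"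
proof -
  let ?V = "verts G"
  have fin: "finite ?V" using assms(1) by (simp add: mixed_graph_def)
  obtain x where x: "sqnorm ?V x = 1"
    and max: "\<And>y. sqnorm ?V (mat_app G y) \<le> sqnorm ?V (mat_app G x) * sqnorm ?V y"
    using sqnorm_maximiser[OF fin assms(2)] by blast
  define m where "m = sqnorm ?V (mat_app G x)"
  define s where "s = sqrt m"
  have s: "s * s = m" "s \<ge> 0" by (simp_all add: s_def m_def sqnorm_nonneg)
  have "(\<Sum>u\<in>?V. mat_app G (mat_app G x) u * cnj (x u)) = of_real m"
    unfolding mat_app_self_adjoint[OF assms(1)] m_def sqnorm_def of_real_sum complex_norm_square ..
  then have "sqnorm ?V (\<lambda>u. mat_app G (mat_app G x) u - of_real m * x u)
      = sqnorm ?V (mat_app G (mat_app G x)) - m * m"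
    by (simp add: sqnorm_diff_scaled x power2_eq_square)
  also have "\<dots> \<le> 0" using max[of "mat_app G x"] by (simp add: m_def)
  finally have "sqnorm ?V (\<lambda>u. mat_app G (mat_app G x) u - of_real m * x u) = 0"
    by (intro antisym sqnorm_nonneg)
  then have NN: "mat_app G (mat_app G x) u = of_real m * x u" if "u \<in> ?V" for u
    using that unfolding sqnorm_eq_0_iff[OF fin] by simp
  \<comment> \<open>On the vertices (N - s)(N + s) x = 0, so y = (N + s) x is an eigenvector for s
    unless it vanishes, and then x itself is one for - s.\<close>
  define y where "y u = mat_app G x u + of_real s * x u" for u
  have y: "mat_app G y u = of_real s * y u" if "u \<in> ?V" for u
  proof -
    have "mat_app G y u = of_real (s * s) * x u + of_real s * mat_app G x u"
      unfolding y_def mat_app_add mat_app_scale NN[OF that] s(1) ..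
    then show ?thesis by (simp add: y_def algebra_simps)
  qed
  have "\<exists>l. is_eigenvalue G l \<and> cmod l = s"
  proof (cases "\<exists>u\<in>?V. y u \<noteq> 0")
    case True
    then have "is_eigenvalue G (of_real s)"
      using y unfolding is_eigenvalue_def mat_app_def by blast
    then show ?thesis using s by (intro exI[of _ "of_real s"]) simp
  next
    case False
    then have "\<forall>u\<in>?V. mat_app G x u = of_real (- s) * x u"
      by (simp add: y_def add_eq_0_iff)
    moreover have "\<exists>u\<in>?V. x u \<noteq> 0" using x sqnorm_pos_iff[OF fin, of x] by simp
    ultimately have "is_eigenvalue G (of_real (- s))"
      unfolding is_eigenvalue_def mat_app_def by blast
    then show ?thesis using s by (intro exI[of _ "of_real (-s)"]) simp
  qed
  then obtain l where "is_eigenvalue G l" "cmod l = s" by blast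
  moreover have "s\<^sup>2 = m" using s by (simp add: power2_eq_square)
  ultimately show thesis using that[of l] max unfolding m_def by simp
qed

text \<open>Needed to give \<open>Max\<close> in the spectral radius its meaning. An enumeration of
  the vertices turns N into a matrix, and its eigenvalues are roots of a monic, hence nonzero,
  characteristic polynomial.\<close>

lemma finite_eigenvalues:
  fixes G :: "'a mgraph"
  assumes "finite (verts G)"
  shows "finite {l. is_eigenvalue G l}"
proof -
  define n where "n = card (verts G)"
  obtain b where b: "bij_betw b {0..<n} (verts G)"
    unfolding n_def using ex_bij_betw_nat_finite[OF assms] by blast
  define M where "M = mat n n (\<lambda>(i, j). Nmat G (b i) (b j))"
  have M: "M \<in> carrier_mat n n" by (simp add: M_def)
  have "eigenvalue M l" if ev: "is_eigenvalue G l" for l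
  proof -
    obtain x where x: "\<exists>v\<in>verts G. x v \<noteq> 0"
      "\<And>u. u \<in> verts G \<Longrightarrow> (\<Sum>v\<in>verts G. Nmat G u v * x v) = l * x u"
      using ev unfolding is_eigenvalue_def by blast
    define y where "y = vec n (\<lambda>i. x (b i))"
    obtain i where "i < n" "x (b i) \<noteq> 0"
      using x(1) bij_betw_imp_surj_on[OF b] by force
    then have "y \<noteq> 0\<^sub>v n" unfolding y_def by (metis index_vec index_zero_vec(1))
    moreover have "M *\<^sub>v y = l \<cdot>\<^sub>v y"
    proof (rule eq_vecI)
      fix i assume "i < dim_vec (l \<cdot>\<^sub>v y)"
      then have i: "i < n" by (simp add: y_def)
      then have "b i \<in> verts G" using bij_betwE[OF b] by simp
      then have "(\<Sum>j\<in>{0..<n}. Nmat G (b i) (b j) * x (b j)) = l * x (b i)"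
        using x(2) sum.reindex_bij_betw[OF b, of "\<lambda>v. Nmat G (b i) v * x v"] by simp
      then show "(M *\<^sub>v y) $ i = (l \<cdot>\<^sub>v y) $ i"
        using i by (simp add: M_def y_def scalar_prod_def)
    qed (simp add: M_def y_def)
    ultimately have "eigenvector M y l" by (simp add: eigenvector_def M_def y_def)
    then show ?thesis unfolding eigenvalue_def by blast
  qed
  then have "{l. is_eigenvalue G l} \<subseteq> {l. poly (char_poly M) l = 0}"
    using eigenvalue_root_char_poly[OF M] by blast
  moreover have "char_poly M \<noteq> 0"
    using degree_monic_char_poly[OF M] by auto
  ultimately show ?thesis using poly_roots_finite finite_subset by blast
qed

lemma subcritical_eigenvalue:
  assumes "finite (verts G)" "subcritical G" "is_eigenvalue G l"
  shows "cmod l < sqrt 3"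
proof -
  let ?V = "verts G"
  obtain x where x: "\<exists>v\<in>?V. x v \<noteq> 0" "\<And>u. u \<in> ?V \<Longrightarrow> mat_app G x u = l * x u"
    using assms(3) unfolding is_eigenvalue_def mat_app_def by blast
  have "sqnorm ?V (mat_app G x) = sqnorm ?V (\<lambda>u. l * x u)"
    by (rule sqnorm_cong) (simp add: x)
  then have "(cmod l)\<^sup>2 * sqnorm ?V x < 3 * sqnorm ?V x"
    using assms(2) x(1) unfolding subcritical_def sqnorm_scale by fastforce
  then have "(cmod l)\<^sup>2 < 3"
    using sqnorm_pos_iff[OF assms(1)] x(1) by (simp add: mult_less_cancel_right_pos)
  then show ?thesis by (rule real_less_rsqrt)
qed

text \<open>\<open>Max\<close> can be unfolded only over a finite nonempty set; nonemptiness is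
  supplied by the dominant eigenvalue.\<close>

lemma spectral_radius_less_sqrt3_iff:
  assumes "mixed_graph G" "verts G \<noteq> {}"
  shows "spectral_radius G < sqrt 3 \<longleftrightarrow> (\<forall>l. is_eigenvalue G l \<longrightarrow> cmod l < sqrt 3)"
proof -
  have "finite {l. is_eigenvalue G l}"
    using assms by (simp add: finite_eigenvalues mixed_graph_def)
  moreover have "{l. is_eigenvalue G l} \<noteq> {}" using dominant_eigenvalue[OF assms] by blast
  ultimately show ?thesis unfolding spectral_radius_def by (subst Max_less_iff) auto
qed

lemma subcritical_if_eigenvalues:
  fixes G :: "'a mgraph"
  assumes "mixed_graph G" "verts G \<noteq> {}" "\<And>l. is_eigenvalue G l \<Longrightarrow> cmod l < sqrt 3"
  shows "subcritical G"
  unfolding subcritical_def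
proof (intro allI impI)
  fix x :: "'a \<Rightarrow> complex" assume x: "\<exists>v\<in>verts G. x v \<noteq> 0"
  obtain l where l: "is_eigenvalue G l"
    "\<And>y. sqnorm (verts G) (mat_app G y) \<le> (cmod l)\<^sup>2 * sqnorm (verts G) y"
    using dominant_eigenvalue[OF assms(1,2)] by blast
  have "(cmod l)\<^sup>2 < (sqrt 3)\<^sup>2" using assms(3)[OF l(1)] by (intro power_strict_mono) auto
  then have "(cmod l)\<^sup>2 * sqnorm (verts G) x < 3 * sqnorm (verts G) x"
    using x assms(1) sqnorm_pos_iff[of "verts G" x]
    by (intro mult_strict_right_mono) (auto simp: mixed_graph_def)
  with l(2)[of x] show "sqnorm (verts G) (mat_app G x) < 3 * sqnorm (verts G) x" by linarith
qed

section \<open>Invariance under switching\<close>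

lemma subcritical_compress:
  assumes "finite (verts G)" "subcritical G" "inj_on h I" "h ` I \<subseteq> verts G"
    and "\<And>i. i \<in> I \<Longrightarrow> cmod (f i) = 1" "\<exists>i\<in>I. y i \<noteq> 0"
  shows "sqnorm I (\<lambda>i. \<Sum>j\<in>I. cnj (f i) * Nmat G (h i) (h j) * f j * y j) < 3 * sqnorm I y"
proof -
  let ?V = "verts G"
  define x where "x v = (if v \<in> h ` I then f (inv_into I h v) * y (inv_into I h v) else 0)" for v
  have x: "x (h i) = f i * y i" if "i \<in> I" for i
    using that assms(3) by (simp add: x_def)
  have cx: "cmod (x (h i)) = cmod (y i)" if "i \<in> I" for i
    using that assms(5) by (simp add: x norm_mult)
  have "sqnorm ?V x = (\<Sum>v\<in>h ` I. (cmod (x v))\<^sup>2)"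
    unfolding sqnorm_def by (rule sum.mono_neutral_right) (use assms in \<open>auto simp: x_def\<close>)
  also have "\<dots> = sqnorm I y"
    by (simp add: sum.reindex[OF assms(3)] sqnorm_def cx)
  finally have nx: "sqnorm ?V x = sqnorm I y" .
  have app: "mat_app G x (h i) = (\<Sum>j\<in>I. Nmat G (h i) (h j) * f j * y j)" for i
  proof -
    have "mat_app G x (h i) = (\<Sum>v\<in>h ` I. Nmat G (h i) v * x v)"
      unfolding mat_app_def by (rule sum.mono_neutral_right) (use assms in \<open>auto simp: x_def\<close>)
    then show ?thesis by (simp add: sum.reindex[OF assms(3)] x mult.assoc)
  qed
  have "sqnorm I (\<lambda>i. \<Sum>j\<in>I. cnj (f i) * Nmat G (h i) (h j) * f j * y j)
      = sqnorm I (\<lambda>i. mat_app G x (h i))"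
  proof (rule sqnorm_cong)
    fix i assume "i \<in> I"
    have "(\<Sum>j\<in>I. cnj (f i) * Nmat G (h i) (h j) * f j * y j) = cnj (f i) * mat_app G x (h i)"
      by (simp add: app sum_distrib_left mult.assoc)
    then show "cmod (\<Sum>j\<in>I. cnj (f i) * Nmat G (h i) (h j) * f j * y j) = cmod (mat_app G x (h i))"
      using assms(5)[OF \<open>i \<in> I\<close>] by (simp add: norm_mult)
  qed
  also have "\<dots> = (\<Sum>v\<in>h ` I. (cmod (mat_app G x v))\<^sup>2)"
    by (simp add: sum.reindex[OF assms(3)] sqnorm_def)
  also have "\<dots> \<le> sqnorm ?V (mat_app G x)"
    unfolding sqnorm_def by (rule sum_mono2) (use assms in auto)
  also have "\<dots> < 3 * sqnorm ?V x"
  proof -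
    obtain i where "i \<in> I" "y i \<noteq> 0" using assms(6) by blast
    then have "h i \<in> ?V" "x (h i) \<noteq> 0" using assms(4) cx[of i] by auto
    then show ?thesis using assms(2) unfolding subcritical_def by blast
  qed
  finally show ?thesis by (simp add: nx)
qed

text \<open>One statement for four uses: induced subgraphs and shorter paths (inclusion, phase 1),
  isomorphisms (a bijection, phase 1) and switchings (identity, phases of the partition).\<close>

lemma subcritical_transfer:
  fixes G :: "'a mgraph" and G' :: "'b mgraph"
  assumes "finite (verts G)" "subcritical G" "inj_on h (verts G')" "h ` verts G' \<subseteq> verts G"
    and "\<And>v. v \<in> verts G' \<Longrightarrow> cmod (f v) = 1"
    and N: "\<And>u v. u \<in> verts G' \<Longrightarrow> v \<in> verts G' \<Longrightarrow>
      Nmat G' u v = cnj (f u) * Nmat G (h u) (h v) * f v"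
  shows "subcritical G'"
  unfolding subcritical_def
proof (intro allI impI)
  fix y :: "'b \<Rightarrow> complex" assume y: "\<exists>v\<in>verts G'. y v \<noteq> 0"
  have "sqnorm (verts G') (mat_app G' y) =
      sqnorm (verts G') (\<lambda>u. \<Sum>v\<in>verts G'. cnj (f u) * Nmat G (h u) (h v) * f v * y v)"
    by (rule sqnorm_cong) (simp add: mat_app_def N)
  also have "\<dots> < 3 * sqnorm (verts G') y"
    by (rule subcritical_compress) (use assms(1-5) y in auto)
  finally show "sqnorm (verts G') (mat_app G' y) < 3 * sqnorm (verts G') y" .
qed

lemma adj_distinct_verts:
  assumes "mixed_graph G" "adj G u v"
  shows "u \<noteq> v" "u \<in> verts G" "v \<in> verts G"
proof -
  have "u \<noteq> v \<and> u \<in> verts G \<and> v \<in> verts G"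
  proof (cases "{u, v} \<in> edges G")
    case True
    then obtain a b where "{u, v} = {a, b}" "a \<noteq> b" "a \<in> verts G" "b \<in> verts G"
      using assms(1) unfolding mixed_graph_def by blast
    then show ?thesis by (auto simp: doubleton_eq_iff)
  qed (use assms in \<open>auto simp: adj_def mixed_graph_def\<close>)
  then show "u \<noteq> v" "u \<in> verts G" "v \<in> verts G" by auto
qed

lemma edges_adjE:
  assumes "mixed_graph G" "e \<in> edges G"
  obtains x y where "e = {x, y}" "adj G x y"
proof -
  from assms obtain x y where "e = {x, y}" unfolding mixed_graph_def by blast
  with assms(2) show thesis by (intro that[of x y]) (simp_all add: adj_def)
qed

lemma mixed_graph_induced: "mixed_graph G \<Longrightarrow> C \<subseteq> verts G \<Longrightarrow> mixed_graph (induced G C)"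
  unfolding mixed_graph_def induced_def by (auto intro: finite_subset) (metis insert_subset)

lemma Nmat_induced: "u \<in> C \<Longrightarrow> v \<in> C \<Longrightarrow> Nmat (induced G C) u v = Nmat G u v"
  by (simp add: Nmat_def induced_def)

lemma adj_induced: "adj (induced G C) u v \<longleftrightarrow> adj G u v \<and> u \<in> C \<and> v \<in> C"
  by (auto simp: adj_def induced_def)

lemma verts_induced: "verts (induced G C) = C"
  by (simp add: induced_def)

lemma subcritical_induced:
  assumes "finite (verts G)" "subcritical G" "C \<subseteq> verts G"
  shows "subcritical (induced G C)"
  by (rule subcritical_transfer[OF assms(1,2), of "\<lambda>v. v" _ "\<lambda>_. 1"])
    (use assms(3) in \<open>auto simp: verts_induced Nmat_induced\<close>)

section \<open>Switching as conjugation by a diagonal matrix\<close>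

lemma T6_norm: "a \<in> T6 \<Longrightarrow> cmod a = 1"
  by (auto simp: T6_def omega_sixth_root)

lemma omega_distinct:
  "omega \<noteq> 1" "cnj omega \<noteq> 1" "omega \<noteq> cnj omega" "- omega \<noteq> 1" "- cnj omega \<noteq> 1"
  "omega \<noteq> - cnj omega" "cnj omega \<noteq> - omega" "omega \<noteq> - omega" "cnj omega \<noteq> - cnj omega"
  "omega \<noteq> 0" "omega \<noteq> -1"
  by (simp_all add: omega_def complex_eq_iff)

text \<open>What happens to a pair u, v depends only on its old type and on the quotient
  \<open>r\<close>. The last fact makes the lemma applicable to the swapped pair with
  \<open>cnj r\<close> in place of \<open>r\<close>, so that both orientations are expressed through
  one number.\<close>

lemma three_way_switch_ratio:
  assumes G: "mixed_graph G" and f: "admissible G f" and u: "u \<in> verts G" and v: "v \<in> verts G"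
    and r: "r = f v / f u"
  shows "(u, v) \<in> arcs (three_way_switch G f) \<longleftrightarrow>
      (u, v) \<in> arcs G \<and> r = 1 \<or> {u, v} \<in> edges G \<and> r = omega \<or> (v, u) \<in> arcs G \<and> r = - cnj omega"
    and "{u, v} \<in> edges (three_way_switch G f) \<longleftrightarrow>
      {u, v} \<in> edges G \<and> r = 1 \<or> (u, v) \<in> arcs G \<and> r = cnj omega \<or> (v, u) \<in> arcs G \<and> r = omega"
    and "{u, v} \<in> edges G \<Longrightarrow> r = 1 \<or> r = omega \<or> r = cnj omega"
    and "(u, v) \<in> arcs G \<Longrightarrow> r = 1 \<or> r = cnj omega \<or> r = - omega"
    and "cnj (f u) * f v = r" "cnj r = f u / f v"
proof -
  have T: "f u \<in> T6" "f v \<in> T6" using f u v by (auto simp: admissible_def)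
  then have c: "cmod (f u) = 1" "cmod (f v) = 1" by (auto intro: T6_norm)
  then have nz: "f u \<noteq> 0" "f v \<noteq> 0" by auto
  have inv: "f u = d * f v \<longleftrightarrow> r = cnj d" if "d * cnj d = 1" for d
  proof -
    have "d \<noteq> 0" using that by auto
    then have "cnj d = 1 / d" using that by (simp add: eq_divide_eq mult.commute)
    then show ?thesis using nz \<open>d \<noteq> 0\<close> by (auto simp: r frac_eq_eq mult.commute)
  qed
  have eq: "f v = f u \<longleftrightarrow> r = 1" "f u = f v \<longleftrightarrow> r = 1" and fw: "f v = d * f u \<longleftrightarrow> r = d" for d
    using nz by (auto simp: r divide_simps)
  have inv': "f u = omega * f v \<longleftrightarrow> r = cnj omega" "f u = cnj omega * f v \<longleftrightarrow> r = omega"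
    "f u = - omega * f v \<longleftrightarrow> r = - cnj omega"
    using inv[of omega] inv[of "cnj omega"] inv[of "- omega"] by (simp_all add: omega_sixth_root(2,3))
  note iffs = eq fw fw[of "- omega", unfolded mult_minus_left] inv' inv'(3)[unfolded mult_minus_left]
  show "(u, v) \<in> arcs (three_way_switch G f) \<longleftrightarrow>
      (u, v) \<in> arcs G \<and> r = 1 \<or> {u, v} \<in> edges G \<and> r = omega \<or> (v, u) \<in> arcs G \<and> r = - cnj omega"
    by (auto simp: three_way_switch_def iffs)
  show "{u, v} \<in> edges (three_way_switch G f) \<longleftrightarrow>
      {u, v} \<in> edges G \<and> r = 1 \<or> (u, v) \<in> arcs G \<and> r = cnj omega \<or> (v, u) \<in> arcs G \<and> r = omega"
  proof -
    have "{u, v} \<in> edges (three_way_switch G f) \<longleftrightarrow>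
        (\<exists>x y. {u, v} = {x, y} \<and> {x, y} \<in> edges G \<and> f y = f x) \<or>
        (\<exists>x y. {u, v} = {x, y} \<and> (x, y) \<in> arcs G \<and> f y = cnj omega * f x)"
      by (auto simp: three_way_switch_def)
    also have "\<dots> \<longleftrightarrow> {u, v} \<in> edges G \<and> f v = f u \<or>
        (u, v) \<in> arcs G \<and> f v = cnj omega * f u \<or> (v, u) \<in> arcs G \<and> f u = cnj omega * f v"
    proof -
      have "(\<exists>x y. {u, v} = {x, y} \<and> P x y) \<longleftrightarrow> P u v \<or> P v u" for P
        unfolding doubleton_eq_iff by blast
      then show ?thesis by (auto simp: insert_commute)
    qed
    finally show ?thesis by (simp only: iffs)
  qed
  show "{u, v} \<in> edges G \<Longrightarrow> r = 1 \<or> r = omega \<or> r = cnj omega"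
    using f unfolding admissible_def by (metis iffs)
  show "(u, v) \<in> arcs G \<Longrightarrow> r = 1 \<or> r = cnj omega \<or> r = - omega"
    using f unfolding admissible_def by (auto simp: iffs)
  have "cnj (f u) = 1 / f u" "cnj (f v) = 1 / f v"
    using c complex_norm_square[of "f u"] complex_norm_square[of "f v"] nz
    by (simp_all add: divide_simps mult.commute)
  then show "cnj (f u) * f v = r" "cnj r = f u / f v"
    using nz by (simp_all add: r)
qed

text \<open>The switching rules are multiplication of the entry by \<open>r\<close>: an edge with r
  = omega gives omega, an arc with r = \<open>cnj omega\<close> gives 1, and an arc with r =
  \<open>- omega\<close> gives - omega^2 = \<open>cnj omega\<close>, the entry of the reversed
  arc.\<close>

lemma Nmat_three_way_switch:
  assumes "mixed_graph G" "admissible G f" "u \<in> verts G" "v \<in> verts G"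
  shows "Nmat (three_way_switch G f) u v = cnj (f u) * Nmat G u v * f v"
proof -
  define r where "r = f v / f u"
  note A = three_way_switch_ratio[OF assms r_def]
  note B = three_way_switch_ratio[OF assms(1,2,4,3) A(6)]
  have m: "(u, v) \<in> arcs G \<Longrightarrow> (v, u) \<notin> arcs G \<and> {u, v} \<notin> edges G"
    "(v, u) \<in> arcs G \<Longrightarrow> (u, v) \<notin> arcs G \<and> {u, v} \<notin> edges G"
    using assms(1) by (auto simp: mixed_graph_def insert_commute)
  have c: "cnj r = x \<longleftrightarrow> r = cnj x" for x by (metis complex_cnj_cnj)
  have "Nmat (three_way_switch G f) u v = r * Nmat G u v"
    unfolding Nmat_def A(1,2) B(1) c
    using A(3,4) B(4) m omega_distinct
    unfolding c
    by (auto simp: insert_commute omega_sixth_root omega_square)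
  then show ?thesis using A(5) by (simp add: mult_ac)
qed

lemma mixed_graph_three_way_switch:
  assumes "mixed_graph G" "admissible G f"
  shows "mixed_graph (three_way_switch G f)"
proof -
  let ?H = "three_way_switch G f"
  have V: "verts ?H = verts G" by (simp add: three_way_switch_def)
  have E: "\<exists>u v. e = {u, v} \<and> u \<noteq> v \<and> u \<in> verts G \<and> v \<in> verts G" if "e \<in> edges ?H" for e
  proof -
    have "e \<in> edges G \<or> (\<exists>x y. e = {x, y} \<and> (x, y) \<in> arcs G)"
      using that by (auto simp: three_way_switch_def)
    then obtain x y where xy: "e = {x, y}" "adj G x y"
      using edges_adjE[OF assms(1)] by (auto simp: adj_def)
    then show ?thesis using adj_distinct_verts[OF assms(1) xy(2)] by blast
  qed
  have Ar: "u \<noteq> v \<and> u \<in> verts G \<and> v \<in> verts G" if "(u, v) \<in> arcs ?H" for u v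
  proof -
    have "adj G u v" using that by (auto simp: three_way_switch_def adj_def insert_commute)
    then show ?thesis using adj_distinct_verts[OF assms(1)] by blast
  qed
  \<comment> \<open>For each old type of the pair, the possible new types belong to different values
    of \<open>r\<close>, so two of them never occur together.\<close>
  have "(v, u) \<notin> arcs ?H \<and> {u, v} \<notin> edges ?H" if "(u, v) \<in> arcs ?H" for u v
  proof -
    have uv: "u \<in> verts G" "v \<in> verts G" using Ar that by auto
    define r where "r = f v / f u"
    note A = three_way_switch_ratio[OF assms uv r_def]
    note B = three_way_switch_ratio[OF assms uv(2,1) A(6)]
    have m: "(u, v) \<in> arcs G \<Longrightarrow> (v, u) \<notin> arcs G \<and> {u, v} \<notin> edges G"
      "(v, u) \<in> arcs G \<Longrightarrow> (u, v) \<notin> arcs G \<and> {u, v} \<notin> edges G"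
      using assms(1) by (auto simp: mixed_graph_def insert_commute)
    have c: "cnj r = x \<longleftrightarrow> r = cnj x" for x by (metis complex_cnj_cnj)
    show ?thesis
      using that m omega_distinct unfolding A(1,2) B(1) c
      by (auto simp: insert_commute)
  qed
  with V E Ar assms(1) show ?thesis unfolding mixed_graph_def by auto
qed

text \<open>The way back conjugates by the inverse phases \<open>cnj (f v)\<close>. They are used
  only as numbers of modulus 1, so the question whether they form an admissible partition of the
  switched graph does not arise.\<close>

lemma subcritical_three_way_switch:
  assumes "mixed_graph G" "admissible G f"
  shows "subcritical (three_way_switch G f) \<longleftrightarrow> subcritical G"
proof
  let ?H = "three_way_switch G f"
  have V: "verts ?H = verts G" by (simp add: three_way_switch_def)
  have fin: "finite (verts G)" using assms(1) by (simp add: mixed_graph_def)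
  have f: "cmod (f v) = 1" if "v \<in> verts G" for v
    using that assms(2) by (auto simp: admissible_def intro: T6_norm)
  note N = Nmat_three_way_switch[OF assms]
  show "subcritical ?H" if "subcritical G"
    by (rule subcritical_transfer[OF fin that, of "\<lambda>v. v" _ f]) (auto simp: V f N)
  show "subcritical G" if "subcritical ?H"
  proof (rule subcritical_transfer[OF _ that, of "\<lambda>v. v" _ "\<lambda>v. cnj (f v)"])
    fix u v assume uv: "u \<in> verts G" "v \<in> verts G"
    then have "f u * cnj (f u) = 1" "f v * cnj (f v) = 1"
      using f complex_norm_square[of "f u"] complex_norm_square[of "f v"] by auto
    then have "cnj (cnj (f u)) * (cnj (f u) * Nmat G u v * f v) * cnj (f v) = Nmat G u v"
      by (metis (no_types, lifting) complex_cnj_cnj mult.assoc mult.left_neutral mult.right_neutral)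
    then show "Nmat G u v = cnj (cnj (f u)) * Nmat ?H u v * cnj (f v)"
      by (simp add: N uv)
  qed (auto simp: V f fin)
qed

section \<open>Reversal of all arcs, and isomorphism\<close>

lemma arcs_reverse: "(u, v) \<in> arcs (reverse_arcs G) \<longleftrightarrow> (v, u) \<in> arcs G"
  by (force simp: reverse_arcs_def image_iff)

lemma edges_reverse: "edges (reverse_arcs G) = edges G"
  and verts_reverse: "verts (reverse_arcs G) = verts G"
  by (simp_all add: reverse_arcs_def)

lemma mixed_graph_reverse:
  assumes "mixed_graph G"
  shows "mixed_graph (reverse_arcs G)"
proof -
  have *: "u \<noteq> v \<and> u \<in> verts G \<and> v \<in> verts G \<and> (v, u) \<notin> arcs G \<and> {v, u} \<notin> edges G"
    if "(u, v) \<in> arcs G" for u v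
    using that assms unfolding mixed_graph_def insert_commute[of v u] by blast
  have "\<forall>(u, v)\<in>arcs (reverse_arcs G). u \<noteq> v \<and> u \<in> verts G \<and> v \<in> verts G"
    "\<forall>(u, v)\<in>arcs (reverse_arcs G). (v, u) \<notin> arcs (reverse_arcs G) \<and> {u, v} \<notin> edges G"
    by (auto simp: arcs_reverse dest: *)
  with assms show ?thesis
    unfolding mixed_graph_def edges_reverse verts_reverse by blast
qed

lemma reverse_reverse: "reverse_arcs (reverse_arcs G) = G"
  by (simp add: reverse_arcs_def image_image split_beta)

text \<open>Reversal replaces N by its entrywise conjugate. This is not given as a conjugation by
  phases, so the vector is conjugated instead, which keeps all norms.\<close>

lemma subcritical_reverse_imp:
  fixes G :: "'a mgraph"
  assumes "mixed_graph G" "subcritical G"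
  shows "subcritical (reverse_arcs G)"
  unfolding subcritical_def verts_reverse
proof (intro allI impI)
  fix x :: "'a \<Rightarrow> complex" assume x: "\<exists>v\<in>verts G. x v \<noteq> 0"
  have N: "Nmat (reverse_arcs G) u v = cnj (Nmat G u v)" for u v
    using assms(1) unfolding Nmat_def arcs_reverse edges_reverse mixed_graph_def by auto
  have "mat_app (reverse_arcs G) x u = cnj (mat_app G (\<lambda>v. cnj (x v)) u)" for u
    by (simp add: mat_app_def verts_reverse N)
  then have "sqnorm (verts G) (mat_app (reverse_arcs G) x)
      = sqnorm (verts G) (mat_app G (\<lambda>v. cnj (x v)))"
    by (simp add: sqnorm_def)
  also have "\<dots> < 3 * sqnorm (verts G) (\<lambda>v. cnj (x v))"
    using assms(2) x unfolding subcritical_def by simp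
  finally show "sqnorm (verts G) (mat_app (reverse_arcs G) x) < 3 * sqnorm (verts G) x"
    by (simp add: sqnorm_def)
qed

lemma subcritical_reverse:
  "mixed_graph G \<Longrightarrow> subcritical (reverse_arcs G) \<longleftrightarrow> subcritical G"
  by (metis subcritical_reverse_imp mixed_graph_reverse reverse_reverse)

lemma switch_steps_preserve:
  assumes "switch_step\<^sup>*\<^sup>* G H" "mixed_graph G"
  shows "mixed_graph H \<and> (subcritical H \<longleftrightarrow> subcritical G)"
  using assms
proof (induction rule: rtranclp_induct)
  case (step H K)
  then show ?case
    unfolding switch_step_def
    by (metis mixed_graph_three_way_switch subcritical_three_way_switch mixed_graph_reverse
        subcritical_reverse)
qed simp

lemma subcritical_iso:
  assumes G: "mixed_graph G" and "mg_iso G H"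
  shows "subcritical G \<longleftrightarrow> subcritical H"
proof
  obtain h where h: "bij_betw h (verts G) (verts H)" "edges H = (\<lambda>e. h ` e) ` edges G"
    "arcs H = (\<lambda>(u, v). (h u, h v)) ` arcs G"
    using assms(2) unfolding mg_iso_def by blast
  have inj: "inj_on h (verts G)" using h(1) by (rule bij_betw_imp_inj_on)
  have fin: "finite (verts G)" "finite (verts H)"
    using G bij_betw_finite[OF h(1)] by (auto simp: mixed_graph_def)
  have N: "Nmat H (h u) (h v) = Nmat G u v" if "u \<in> verts G" "v \<in> verts G" for u v
  proof -
    have "(h a, h b) \<in> arcs H \<longleftrightarrow> (a, b) \<in> arcs G" if "a \<in> verts G" "b \<in> verts G" for a b
    proof
      assume "(h a, h b) \<in> arcs H"
      then obtain c d where cd: "(c, d) \<in> arcs G" "h c = h a" "h d = h b"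
        unfolding h(3) by auto
      then have "c \<in> verts G" "d \<in> verts G"
        using adj_distinct_verts[OF G, of c d] by (auto simp: adj_def)
      then have "c = a" "d = b" using inj_onD[OF inj] cd that by blast+
      with cd show "(a, b) \<in> arcs G" by simp
    qed (force simp: h(3))
    moreover have "{h u, h v} \<in> edges H \<longleftrightarrow> {u, v} \<in> edges G"
    proof -
      \<comment> \<open>\<open>h\<close> is injective on the vertices only; equality of images can
        be cancelled only for sets known to lie among them.\<close>
      have "e \<subseteq> verts G" if "e \<in> edges G" for e
        using edges_adjE[OF G that] adj_distinct_verts[OF G] by (metis empty_subsetI insert_subset)
      then have "h ` e = h ` {u, v} \<longleftrightarrow> e = {u, v}" if "e \<in> edges G" for e
        using that \<open>u \<in> verts G\<close> \<open>v \<in> verts G\<close> by (intro inj_on_image_eq_iff[OF inj]) auto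
      then show ?thesis unfolding h(2) by (auto simp: image_iff) 
    qed
    ultimately show ?thesis using that by (simp add: Nmat_def)
  qed
  show "subcritical G" if "subcritical H"
    by (rule subcritical_transfer[OF fin(2) that inj, of "\<lambda>_. 1"])
      (use h(1) in \<open>auto simp: N bij_betw_def\<close>)
  let ?g = "inv_into (verts G) h"
  have g: "bij_betw ?g (verts H) (verts G)" using h(1) by (rule bij_betw_inv_into)
  show "subcritical H" if "subcritical G"
  proof (rule subcritical_transfer[OF fin(1) that, of ?g _ "\<lambda>_. 1"])
    fix u v assume "u \<in> verts H" "v \<in> verts H"
    then show "Nmat H u v = cnj 1 * Nmat G (?g u) (?g v) * 1"
      using N[of "?g u" "?g v"] bij_betw_inv_into_right[OF h(1)] bij_betwE[OF g] by auto
  qed (use g in \<open>auto simp: bij_betw_def\<close>)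
qed

lemma subcritical_switching_equivalent:
  assumes "mixed_graph G" "mixed_graph H" "switching_equivalent G H"
  shows "subcritical G \<longleftrightarrow> subcritical H"
  using assms unfolding switching_equivalent_def
  by (metis subcritical_iso switch_steps_preserve)

section \<open>The paths and the 4-cycle are subcritical\<close>

lemma mixed_graph_path: "mixed_graph (path_mg k)"
  by (fastforce simp: mixed_graph_def path_mg_def)

lemma Nmat_path: "Nmat (path_mg k) i j = (if (j = Suc i \<or> i = Suc j) \<and> i < k \<and> j < k then 1 else 0)"
  by (auto simp: Nmat_def path_mg_def doubleton_eq_iff)

lemma mixed_graph_C4eq: "mixed_graph C4eq"
  by (fastforce simp: mixed_graph_def C4eq_def doubleton_eq_iff)

text \<open>The weights 5/2 and 5/3 in (a + b)^2 <= 5/2 a^2 + 5/3 b^2 keep both resulting coefficients,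
  5/2 and 5/3 + 1, below 3.\<close>
lemma cmod_add_square: "(cmod (a + b))\<^sup>2 \<le> 5/2 * (cmod a)\<^sup>2 + 5/3 * (cmod b)\<^sup>2"
proof -
  have real: "(x + y)\<^sup>2 \<le> 5/2 * x\<^sup>2 + 5/3 * y\<^sup>2" for x y :: real
    using zero_le_power2[of "3 * x - 2 * y"] by (simp add: power2_eq_square algebra_simps)
  show ?thesis
    using real[of "Re a" "Re b"] real[of "Im a" "Im b"]
    unfolding cmod_power2 plus_complex.sel distrib_left by linarith
qed

lemma subcritical_path4: "subcritical (path_mg 4)"
  unfolding subcritical_def
proof (intro allI impI)
  fix x :: "nat \<Rightarrow> complex" assume x: "\<exists>v\<in>verts (path_mg 4). x v \<noteq> 0"
  have V: "verts (path_mg 4) = {0, 1, 2, 3}" by (auto simp: path_mg_def)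
  have "sqnorm {0, 1, 2, 3} (mat_app (path_mg 4) x)
      = (cmod (x 1))\<^sup>2 + (cmod (x 2 + x 0))\<^sup>2 + (cmod (x 1 + x 3))\<^sup>2 + (cmod (x 2))\<^sup>2"
    by (simp add: sqnorm_def mat_app_def V Nmat_path add.commute)
  \<comment> \<open>The weight 5/2 falls on the end vertices and 5/3 on the inner ones. Each inner
    value also occurs once alone, and 5/3 + 1 = 8/3 is the larger coefficient.\<close>
  also have "\<dots> \<le> 8/3 * sqnorm {0, 1, 2, 3} x"
  proof -
    have "sqnorm {0, 1, 2, 3} x
        = (cmod (x 0))\<^sup>2 + (cmod (x 1))\<^sup>2 + (cmod (x 2))\<^sup>2 + (cmod (x 3))\<^sup>2"
      by (simp add: sqnorm_def)
    then show ?thesis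
      using cmod_add_square[of "x 0" "x 2"] cmod_add_square[of "x 3" "x 1"]
        zero_le_power2[of "cmod (x 0)"] zero_le_power2[of "cmod (x 3)"]
      unfolding add.commute[of "x 1"] add.commute[of "x 2"] by linarith
  qed
  also have "\<dots> < 3 * sqnorm {0, 1, 2, 3} x"
    using x sqnorm_pos_iff[of "{0, 1, 2, 3}" x] unfolding V by simp
  finally show "sqnorm (verts (path_mg 4)) (mat_app (path_mg 4) x) < 3 * sqnorm (verts (path_mg 4)) x"
    by (simp add: V)
qed

text \<open>Shorter paths sit in \<open>path_mg 4\<close> as initial segments, so one computation
  serves all.\<close>

lemma subcritical_path:
  assumes "k \<le> 4"
  shows "subcritical (path_mg k)"
  by (rule subcritical_transfer[OF _ subcritical_path4, of "\<lambda>v. v" _ "\<lambda>_. 1"])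
    (use assms in \<open>auto simp: Nmat_path, auto simp: path_mg_def\<close>)

text \<open>The two cross terms cancel because cnj omega ^ 2 = - omega: this is the weight -1 of the
  cycle.\<close>
lemma cancelling_pair:
  "(cmod (omega * a + b))\<^sup>2 + (cmod (cnj omega * a + omega * b))\<^sup>2
    = 2 * ((cmod a)\<^sup>2 + (cmod b)\<^sup>2)"
  "(cmod (omega * a + cnj omega * b))\<^sup>2 + (cmod (b + cnj omega * a))\<^sup>2
    = 2 * ((cmod a)\<^sup>2 + (cmod b)\<^sup>2)"
proof -
  have sq: "(cmod (z + w))\<^sup>2 = (cmod z)\<^sup>2 + (cmod w)\<^sup>2 + 2 * Re (z * cnj w)" for z w
    by (simp only: cmod_power2) (simp add: power2_eq_square algebra_simps)
  have lin: "A + B + 2 * p + (A + B + 2 * q) = 2 * (A + B)" if "p + q = 0" for A B p q :: real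
    using that by simp
  have "omega * a * cnj b + cnj omega * a * cnj (omega * b)
      = (omega + cnj omega * cnj omega) * (a * cnj b)"
    by (simp add: algebra_simps)
  then have "Re (omega * a * cnj b + cnj omega * a * cnj (omega * b)) = 0"
    by (simp only: omega_square) simp
  then have 1: "Re (omega * a * cnj b) + Re (cnj omega * a * cnj (omega * b)) = 0"
    by (simp only: plus_complex.sel)
  have "omega * a * cnj (cnj omega * b) = (omega * omega) * (a * cnj b)"
    by (simp add: mult_ac)
  also have "\<dots> = - cnj (b * cnj (cnj omega * a))"
    unfolding omega_square by (simp add: mult_ac)
  finally have 2: "Re (omega * a * cnj (cnj omega * b)) + Re (b * cnj (cnj omega * a)) = 0"
    by (simp only: uminus_complex.sel cnj.sel)
  show "(cmod (omega * a + b))\<^sup>2 + (cmod (cnj omega * a + omega * b))\<^sup>2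
      = 2 * ((cmod a)\<^sup>2 + (cmod b)\<^sup>2)"
    unfolding sq norm_mult complex_mod_cnj omega_sixth_root(1) mult_1 by (rule lin[OF 1])
  show "(cmod (omega * a + cnj omega * b))\<^sup>2 + (cmod (b + cnj omega * a))\<^sup>2
      = 2 * ((cmod a)\<^sup>2 + (cmod b)\<^sup>2)"
    unfolding sq norm_mult complex_mod_cnj omega_sixth_root(1) mult_1
      add.commute[of "(cmod b)\<^sup>2" "(cmod a)\<^sup>2"] by (rule lin[OF 2])
qed

lemma subcritical_C4eq: "subcritical C4eq"
  unfolding subcritical_def
proof (intro allI impI)
  fix x :: "nat \<Rightarrow> complex" assume x: "\<exists>v\<in>verts C4eq. x v \<noteq> 0"
  have V: "verts C4eq = {0, 1, 2, 3}" by (simp add: C4eq_def)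
  have "sqnorm {0, 1, 2, 3} (mat_app C4eq x)
      = (cmod (omega * x 1 + x 3))\<^sup>2 + (cmod (cnj omega * x 0 + omega * x 2))\<^sup>2
        + (cmod (cnj omega * x 1 + omega * x 3))\<^sup>2 + (cmod (x 0 + cnj omega * x 2))\<^sup>2"
    by (simp add: sqnorm_def mat_app_def V Nmat_def C4eq_def doubleton_eq_iff)
  \<comment> \<open>Rows 0 and 2 involve only \<open>x 1\<close> and \<open>x 3\<close>, rows 1 and
    3 only \<open>x 0\<close> and \<open>x 2\<close>. Cancellation within each pair gives an
    equality: every vector is stretched by exactly sqrt 2.\<close>
  also have "\<dots> = 2 * sqnorm {0, 1, 2, 3} x"
    using cancelling_pair(1)[of "x 1" "x 3"] cancelling_pair(2)[of "x 2" "x 0"]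
    by (simp add: sqnorm_def add.commute)
  also have "\<dots> < 3 * sqnorm {0, 1, 2, 3} x"
    using x sqnorm_pos_iff[of "{0, 1, 2, 3}" x] unfolding V by simp
  finally show "sqnorm (verts C4eq) (mat_app C4eq x) < 3 * sqnorm (verts C4eq) x"
    by (simp add: V)
qed

section \<open>Test vectors on paths\<close>

text \<open>Chords are allowed, so a path need not be induced; which chords can exist is a
  consequence of the degree bound.\<close>

definition is_path :: "'a mgraph \<Rightarrow> 'a list \<Rightarrow> bool" where
  "is_path G vs \<longleftrightarrow> distinct vs \<and> set vs \<subseteq> verts G \<and>
     (\<forall>i. Suc i < length vs \<longrightarrow> adj G (vs ! i) (vs ! Suc i))"

text \<open>Conjugating N by the diagonal matrix of these phases turns every entry of N along the path
  into 1.\<close>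
definition gauge :: "'a mgraph \<Rightarrow> 'a list \<Rightarrow> nat \<Rightarrow> complex" where
  "gauge G vs i = (\<Prod>j<i. cnj (Nmat G (vs ! j) (vs ! Suc j)))"

definition gauged :: "'a mgraph \<Rightarrow> 'a list \<Rightarrow> nat \<Rightarrow> nat \<Rightarrow> complex" where
  "gauged G vs i j = cnj (gauge G vs i) * Nmat G (vs ! i) (vs ! j) * gauge G vs j"

lemma T6_mult: "a \<in> T6 \<Longrightarrow> b \<in> T6 \<Longrightarrow> a * b \<in> T6"
  unfolding T6_def by (elim insertE emptyE; simp add: omega_square omega_sixth_root(2,3))

lemma T6_cnj: "a \<in> T6 \<Longrightarrow> cnj a \<in> T6"
  by (auto simp: T6_def)

lemma Nmat_T6: "adj G u v \<Longrightarrow> Nmat G u v \<in> T6"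
  by (auto simp: Nmat_def adj_def T6_def)

lemma is_path_adj: "is_path G vs \<Longrightarrow> Suc i < length vs \<Longrightarrow> adj G (vs ! i) (vs ! Suc i)"
  by (simp add: is_path_def)

text \<open>Modulus 1 would do for the test vectors. Membership in \<open>T6\<close> lets the same
  phases label the partition of a switching.\<close>

lemma gauge_T6: "is_path G vs \<Longrightarrow> i < length vs \<Longrightarrow> gauge G vs i \<in> T6"
proof (induction i)
  case 0
  then show ?case by (simp add: gauge_def T6_def)
next
  case (Suc i)
  then have "gauge G vs i \<in> T6" "cnj (Nmat G (vs ! i) (vs ! Suc i)) \<in> T6"
    by (auto simp: is_path_def intro: T6_cnj Nmat_T6)
  then have "gauge G vs i * cnj (Nmat G (vs ! i) (vs ! Suc i)) \<in> T6" by (rule T6_mult)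
  then show ?case by (simp add: gauge_def)
qed

lemma T6_cancel: "a \<in> T6 \<Longrightarrow> a * cnj a = 1"
  using T6_norm[of a] by (simp add: complex_norm_square[symmetric])

lemma gauged_T6:
  "is_path G vs \<Longrightarrow> i < length vs \<Longrightarrow> j < length vs \<Longrightarrow> adj G (vs ! i) (vs ! j) \<Longrightarrow> gauged G vs i j \<in> T6"
  unfolding gauged_def by (intro T6_mult T6_cnj gauge_T6 Nmat_T6)

lemma gauged_eq_0: "\<not> adj G (vs ! i) (vs ! j) \<Longrightarrow> gauged G vs i j = 0"
  by (simp add: gauged_def Nmat_eq_0_iff)

lemma gauged_hermitian: "mixed_graph G \<Longrightarrow> gauged G vs j i = cnj (gauged G vs i j)"
  using Nmat_hermitian[of G "vs ! j" "vs ! i"] by (simp add: gauged_def mult_ac)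

lemma gauged_Suc:
  assumes "is_path G vs" "Suc i < length vs"
  shows "gauged G vs i (Suc i) = 1"
proof -
  let ?g = "gauge G vs i" and ?n = "Nmat G (vs ! i) (vs ! Suc i)"
  have "adj G (vs ! i) (vs ! Suc i)" using assms by (simp add: is_path_def)
  then have "?n * cnj ?n = 1" by (intro T6_cancel Nmat_T6)
  moreover have "?g * cnj ?g = 1" using assms by (intro T6_cancel gauge_T6) auto
  moreover have "gauged G vs i (Suc i) = (?g * cnj ?g) * (?n * cnj ?n)"
    by (simp add: gauged_def gauge_def mult_ac)
  ultimately show ?thesis by simp
qed

lemma gauged_path_test:
  assumes "mixed_graph G" "subcritical G" "is_path G vs" "\<exists>i<length vs. y i \<noteq> 0"
  shows "sqnorm {..<length vs} (\<lambda>i. \<Sum>j<length vs. gauged G vs i j * y j)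
    < 3 * sqnorm {..<length vs} y"
proof -
  have "sqnorm {..<length vs} (\<lambda>i. \<Sum>j\<in>{..<length vs}.
      cnj (gauge G vs i) * Nmat G (vs ! i) (vs ! j) * gauge G vs j * y j) < 3 * sqnorm {..<length vs} y"
  proof (rule subcritical_compress)
    show "finite (verts G)" "subcritical G" using assms by (auto simp: mixed_graph_def)
    show "inj_on ((!) vs) {..<length vs}" "(!) vs ` {..<length vs} \<subseteq> verts G"
      using assms(3) by (auto simp: is_path_def inj_on_def nth_eq_iff_index_eq)
    show "cmod (gauge G vs i) = 1" if "i \<in> {..<length vs}" for i
      using that assms(3) by (intro T6_norm gauge_T6) auto
  qed (use assms(4) in auto)
  then show ?thesis by (simp add: gauged_def)
qed

text \<open>The test vector is the indicator of \<open>a\<close>. Its image is column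
  \<open>a\<close> of N, whose squared norm is the degree, whatever edges join the
  neighbours.\<close>

lemma subcritical_degree:
  assumes G: "mixed_graph G" and "subcritical G"
    and abcd: "adj G a b" "adj G a c" "adj G a d" "b \<noteq> c" "b \<noteq> d" "c \<noteq> d"
  shows False
proof -
  let ?V = "verts G"
  define x :: "'a \<Rightarrow> complex" where "x v = (if v = a then 1 else 0)" for v
  have fin: "finite ?V" using G by (simp add: mixed_graph_def)
  have a: "a \<in> ?V" and bcd: "{b, c, d} \<subseteq> ?V" using adj_distinct_verts[OF G] abcd by auto
  have adj: "adj G u a" if "u \<in> {b, c, d}" for u
    using that abcd by (auto simp: adj_def insert_commute)
  have app: "mat_app G x u = Nmat G u a" for u
    using fin a by (simp add: mat_app_def x_def if_distrib[of "\<lambda>z. _ * z"] cong: if_cong)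
  have x1: "sqnorm ?V x = 1"
  proof -
    have "(cmod (x v))\<^sup>2 = (if v = a then 1 else 0)" for v by (simp add: x_def)
    then show ?thesis using fin a by (simp add: sqnorm_def)
  qed
  have "3 = sqnorm {b, c, d} (mat_app G x)"
    using abcd adj by (simp add: sqnorm_def app cmod_Nmat)
  also have "\<dots> \<le> sqnorm ?V (mat_app G x)"
    unfolding sqnorm_def by (rule sum_mono2[OF fin bcd]) simp
  also have "\<dots> < 3 * sqnorm ?V x"
    using assms(2) a unfolding subcritical_def by (auto simp: x_def)
  finally show False by (simp add: x1)
qed

lemma adj_sym: "adj G u v \<longleftrightarrow> adj G v u"
  by (auto simp: adj_def insert_commute)

lemma path_inner_neighbours:
  assumes G: "mixed_graph G" "subcritical G" and p: "is_path G vs"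
    and i: "0 < i" "Suc i < length vs" and z: "adj G (vs ! i) z"
  shows "z = vs ! (i - 1) \<or> z = vs ! Suc i"
proof (rule ccontr)
  assume "\<not> ?thesis"
  moreover have "adj G (vs ! i) (vs ! (i - 1))"
    using is_path_adj[OF p, of "i - 1"] i by (simp add: adj_sym)
  moreover have "adj G (vs ! i) (vs ! Suc i)"
    using is_path_adj[OF p] i by simp
  moreover have "vs ! (i - 1) \<noteq> vs ! Suc i"
    using p i unfolding is_path_def by (auto simp: nth_eq_iff_index_eq)
  ultimately show False
    using subcritical_degree[OF G, of "vs ! i" "vs ! (i - 1)" "vs ! Suc i" z] z by auto
qed

text \<open>An endpoint of the chord that is inner on the path would have a third neighbour, so the
  chord joins the two ends of the path.\<close>

lemma path_chord:
  assumes G: "mixed_graph G" "subcritical G" and p: "is_path G vs"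
    and ij: "Suc i < j" "j < length vs" and a: "adj G (vs ! i) (vs ! j)"
  shows "i = 0 \<and> Suc j = length vs"
proof -
  have dist: "vs ! k = vs ! l \<longleftrightarrow> k = l" if "k < length vs" "l < length vs" for k l
    using p that by (auto simp: is_path_def nth_eq_iff_index_eq)
  have "i = 0"
    using path_inner_neighbours[OF G p, of i "vs ! j"] a ij by (cases "i = 0") (auto simp: dist)
  moreover have "\<not> Suc j < length vs"
    using path_inner_neighbours[OF G p, of j "vs ! i"] a ij
    by (cases "Suc j < length vs") (auto simp: dist adj_sym[of G "vs ! j"])
  ultimately show ?thesis using ij by auto
qed

text \<open>The gauged matrix is that of an undirected path except for its corners. The corner
  \<open>w\<close> is 0 if there is no chord; otherwise it is the conjugate of the weight of the
  cycle that the chord closes.\<close>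

lemma gauged_entries:
  assumes G: "mixed_graph G" "subcritical G" and p: "is_path G vs"
    and w: "w = gauged G vs 0 (length vs - 1)" and ij: "i < length vs" "j < length vs"
  shows "gauged G vs i j =
    (if j = Suc i \<or> i = Suc j then 1
     else if i = 0 \<and> Suc j = length vs \<and> i \<noteq> j then w
     else if j = 0 \<and> Suc i = length vs \<and> i \<noteq> j then cnj w else 0)"
proof -
  have up: "gauged G vs i j = (if j = Suc i then 1
      else if i = 0 \<and> Suc j = length vs then w else 0)"
    if "i < j" "j < length vs" for i j
  proof (cases "j = Suc i \<or> i = 0 \<and> Suc j = length vs")
    case True
    then show ?thesis
    proof
      assume "i = 0 \<and> Suc j = length vs"
      then have "i = 0" "length vs - 1 = j" by auto
      then show ?thesis using gauged_Suc[OF p, of i] that w by auto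
    qed (use gauged_Suc[OF p, of i] that in auto)
  next
    case False
    then have "\<not> adj G (vs ! i) (vs ! j)" using path_chord[OF G p, of i j] that by auto
    then show ?thesis using False gauged_eq_0 by auto
  qed
  consider "i < j" | "j < i" | "i = j" by linarith
  then show ?thesis
  proof cases
    case 1
    then show ?thesis using up[of i j] ij by auto
  next
    case 2
    then show ?thesis using up[of j i] ij gauged_hermitian[OF G(1), of vs i j] by auto
  next
    case 3
    then show ?thesis using adj_distinct_verts(1)[OF G(1)] by (auto intro: gauged_eq_0)
  qed
qed

lemma cmod_of_real_add_square: "(cmod (of_real t + w))\<^sup>2 = t\<^sup>2 + 2 * t * Re w + (cmod w)\<^sup>2"
  by (simp only: cmod_power2) (simp add: power2_eq_square algebra_simps)

lemma sign_choice:
  obtains s :: real where "s = 1 \<or> s = -1" "s * x = \<bar>x\<bar>"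
  by (cases "x \<ge> 0") (auto intro: that[of 1] that[of "-1"])

text \<open>The test vector is an eigenvector of the path for the eigenvalue sqrt 3 or - sqrt 3; the sign is
  chosen so that a possible edge between the end vertices can only increase the norm.\<close>
lemma no_path_5:
  assumes G: "mixed_graph G" "subcritical G" and p: "is_path G vs" and l: "length vs = 5"
  shows False
proof -
  have sum5: "(\<Sum>i<5. f i) = f 0 + f 1 + f 2 + f 3 + f 4" for f :: "nat \<Rightarrow> 'b :: comm_monoid_add"
    by (simp add: eval_nat_numeral)
  define w where "w = gauged G vs 0 4"
  then have "w = gauged G vs 0 (length vs - 1)" by (simp add: l)
  note M = gauged_entries[OF G p this, unfolded l]
  obtain s :: real where s: "s = 1 \<or> s = -1" "s * Re w = \<bar>Re w\<bar>" by (rule sign_choice)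
  define t where "t = s * sqrt 3"
  have "t * Re w = sqrt 3 * \<bar>Re w\<bar>" by (simp add: t_def flip: s(2))
  then have "t * Re w \<ge> 0" by simp
  moreover have "t\<^sup>2 = 3" using s(1) by (auto simp: t_def)
  ultimately have t: "t\<^sup>2 = 3" "t * Re w \<ge> 0" by simp_all
  define y :: "nat \<Rightarrow> complex" where
    "y i = of_real (if i = 0 \<or> i = 4 then 1 else if i = 2 then 2 else t)" for i
  have "\<exists>i<length vs. y i \<noteq> 0" by (intro exI[of _ 0]) (simp add: l y_def)
  from gauged_path_test[OF G p this]
  have "sqnorm {..<5} (\<lambda>i. \<Sum>j<5. gauged G vs i j * y j) < 3 * sqnorm {..<5} y"
    by (simp only: l)
  also have "sqnorm {..<5} y = 12"
    using t by (simp add: sqnorm_def sum5 y_def)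
  also have "sqnorm {..<5} (\<lambda>i. \<Sum>j<5. gauged G vs i j * y j) =
      (cmod (of_real t + w))\<^sup>2 + 9 + (cmod (of_real (2 * t)))\<^sup>2 + 9 + (cmod (of_real t + cnj w))\<^sup>2"
    by (simp add: sqnorm_def sum5 M y_def add.commute flip: of_real_add)
  finally show False
    using t zero_le_power2[of "cmod w"]
    by (simp add: cmod_of_real_add_square norm_mult power_mult_distrib)
qed

text \<open>No sixth root of unity is near the imaginary axis, so the edge that closes a triangle
  changes the norm by a definite amount once the sign of the test vector suits it.\<close>

lemma T6_Re: "w \<in> T6 \<Longrightarrow> \<bar>Re w\<bar> \<ge> 1/2"
  by (auto simp: T6_def omega_def)

text \<open>The vector (1, t, 1) with t = sqrt 2 or - sqrt 2 is an eigenvector of the path with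
  three vertices. If the sign makes t Re w positive, each end row contributes at least 2 + 1 + 1 = 4
  and the middle row 4, in total 12 = 3 * 4.\<close>

lemma no_triangle:
  assumes G: "mixed_graph G" "subcritical G" and p: "is_path G vs" and l: "length vs = 3"
  shows "\<not> adj G (vs ! 0) (vs ! 2)"
proof
  assume a: "adj G (vs ! 0) (vs ! 2)"
  have sum3: "(\<Sum>i<3. f i) = f 0 + f 1 + f 2" for f :: "nat \<Rightarrow> 'b :: comm_monoid_add"
    by (simp add: eval_nat_numeral)
  define w where "w = gauged G vs 0 2"
  then have "w = gauged G vs 0 (length vs - 1)" by (simp add: l)
  note M = gauged_entries[OF G p this, unfolded l]
  have w: "w \<in> T6" using gauged_T6[OF p _ _ a] l by (simp add: w_def)
  obtain s :: real where s: "s = 1 \<or> s = -1" "s * Re w = \<bar>Re w\<bar>" by (rule sign_choice)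
  define t where "t = s * sqrt 2"
  have "1 * (1/2) \<le> sqrt 2 * \<bar>Re w\<bar>"
    using T6_Re[OF w] by (intro mult_mono) auto
  moreover have "t * Re w = sqrt 2 * \<bar>Re w\<bar>" by (simp add: t_def flip: s(2))
  ultimately have "2 * t * Re w \<ge> 1" by simp
  moreover have "t\<^sup>2 = 2" using s(1) by (auto simp: t_def)
  ultimately have t: "t\<^sup>2 = 2" "2 * t * Re w \<ge> 1" by simp_all
  define y :: "nat \<Rightarrow> complex" where "y i = of_real (if i = 1 then t else 1)" for i
  have "\<exists>i<length vs. y i \<noteq> 0" by (intro exI[of _ 0]) (simp add: l y_def)
  from gauged_path_test[OF G p this]
  have "sqnorm {..<3} (\<lambda>i. \<Sum>j<3. gauged G vs i j * y j) < 3 * sqnorm {..<3} y"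
    by (simp only: l)
  also have "sqnorm {..<3} y = 4"
    using t by (simp add: sqnorm_def sum3 y_def)
  also have "sqnorm {..<3} (\<lambda>i. \<Sum>j<3. gauged G vs i j * y j) =
      (cmod (of_real t + w))\<^sup>2 + 4 + (cmod (of_real t + cnj w))\<^sup>2"
    by (simp add: sqnorm_def sum3 M y_def add.commute)
  finally show False
    using t T6_norm[OF w] by (simp add: cmod_of_real_add_square)
qed

text \<open>For w = - omega and w = - cnj omega the bound sqrt 3 is attained, so the test vectors must be the
  exact eigenvectors, the powers of a primitive twelfth root of unity.\<close>
lemma four_cycle_weight:
  assumes G: "mixed_graph G" "subcritical G" and p: "is_path G vs" and l: "length vs = 4"
    and a: "adj G (vs ! 0) (vs ! 3)"
  shows "gauged G vs 0 3 = -1"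
proof -
  have sum4: "(\<Sum>i<4. f i) = f 0 + f 1 + f 2 + f 3" for f :: "nat \<Rightarrow> 'b :: comm_monoid_add"
    by (simp add: eval_nat_numeral)
  define w where "w = gauged G vs 0 3"
  then have "w = gauged G vs 0 (length vs - 1)" by (simp add: l)
  note M = gauged_entries[OF G p this, unfolded l]
  have w: "w \<in> T6" using gauged_T6[OF p _ _ a] l by (simp add: w_def)
  have test: "(cmod (y1 + w * y3))\<^sup>2 + (cmod (1 + y2))\<^sup>2 + (cmod (y1 + y3))\<^sup>2 + (cmod (cnj w + y2))\<^sup>2
      < 3 * (1 + (cmod y1)\<^sup>2 + (cmod y2)\<^sup>2 + (cmod y3)\<^sup>2)" for y1 y2 y3
  proof -
    define y :: "nat \<Rightarrow> complex" where
      "y i = (if i = 0 then 1 else if i = 1 then y1 else if i = 2 then y2 else y3)" for i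
    have "\<exists>i<length vs. y i \<noteq> 0" by (intro exI[of _ 0]) (simp add: l y_def)
    from gauged_path_test[OF G p this]
    have "sqnorm {..<4} (\<lambda>i. \<Sum>j<4. gauged G vs i j * y j) < 3 * sqnorm {..<4} y"
      by (simp only: l)
    then show ?thesis
      by (simp add: sqnorm_def sum4 M y_def)
  qed
  \<comment> \<open>The constant vector gives 16 for w = 1, and 3 + 4 + 4 + 3 = 14 when Re w = 1/2;
    both violate the bound 12.\<close>
  have "w \<noteq> 1" using test[of 1 1 1] by auto
  moreover have "w \<noteq> omega" "w \<noteq> cnj omega" using test[of 1 1 1, unfolded cmod_power2]
    by (auto simp: omega_def power2_eq_square field_simps)
  \<comment> \<open>Instantiation follows the order of occurrence y1, y3, y2 in \<open>test\<close>.
    With z = exp (i pi / 6) the vector is thus (1, z, z^2, z^3), and for w = \<open>- omega\<close>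
    it is multiplied by sqrt 3. The next case uses the conjugate vector.\<close>
  moreover have "w \<noteq> - omega" using test[of "Complex (sqrt 3 / 2) (1/2)" \<i> omega, unfolded cmod_power2]
    by (auto simp: omega_def power2_eq_square field_simps)
  moreover have "w \<noteq> - cnj omega" using test[of "Complex (sqrt 3 / 2) (-1/2)" "-\<i>" "cnj omega", unfolded cmod_power2]
    by (auto simp: omega_def power2_eq_square field_simps)
  ultimately have "w = -1" using w by (auto simp: T6_def)
  then show ?thesis by (simp add: w_def)
qed

section \<open>Classification of connected subcritical graphs\<close>

lemma is_path_take: "is_path G vs \<Longrightarrow> is_path G (take n vs)"
  unfolding is_path_def by (auto dest: in_set_takeD)

lemma is_path_length_le_4:
  assumes "mixed_graph G" "subcritical G" "is_path G vs"
  shows "length vs \<le> 4"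
  using no_path_5[OF assms(1,2) is_path_take[OF assms(3), of 5]] by fastforce

lemma is_path_Cons:
  assumes "is_path G vs" "vs \<noteq> []" "z \<in> verts G" "z \<notin> set vs" "adj G z (vs ! 0)"
  shows "is_path G (z # vs)"
  using assms unfolding is_path_def by (auto simp: nth_Cons split: nat.split)

lemma is_path_snoc:
  assumes "is_path G vs" "z \<in> verts G" "z \<notin> set vs" "adj G (vs ! (length vs - 1)) z"
  shows "is_path G (vs @ [z])"
proof -
  have "adj G ((vs @ [z]) ! i) ((vs @ [z]) ! Suc i)" if i: "Suc i < length (vs @ [z])" for i
  proof (cases "Suc i < length vs")
    case True
    then show ?thesis using is_path_adj[OF assms(1) True] by (simp add: nth_append)
  next
    case False
    then have "i = length vs - 1" "Suc i = length vs" using i by auto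
    then show ?thesis using assms(4) by (simp add: nth_append)
  qed
  then show ?thesis using assms unfolding is_path_def by auto
qed

text \<open>The vertices of a longest path are closed under adjacency: a new neighbour of an end
  would extend the path, and an inner vertex has its two neighbours on the path already.
  Connectedness is assumed in the form that fits this argument, that a nonempty closed set is
  everything.\<close>

lemma spanning_path:
  assumes G: "mixed_graph G" "subcritical G" and ne: "verts G \<noteq> {}"
    and conn: "\<And>S. S \<subseteq> verts G \<Longrightarrow> S \<noteq> {} \<Longrightarrow> (\<And>u v. u \<in> S \<Longrightarrow> adj G u v \<Longrightarrow> v \<in> S) \<Longrightarrow> S = verts G"
  obtains vs where "is_path G vs" "set vs = verts G" "vs \<noteq> []"
proof -
  obtain v where v: "v \<in> verts G" using ne by blast
  then have "is_path G [v]" by (simp add: is_path_def)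
  then have "\<exists>vs. is_path G vs \<and> (\<forall>us. is_path G us \<longrightarrow> length us \<le> length vs)"
    by (rule ex_has_greatest_nat[where b = 5]) (use is_path_length_le_4[OF G] in \<open>auto simp: less_Suc_eq_le numeral_eq_Suc\<close>)
  then obtain vs where p: "is_path G vs" and max: "\<And>us. is_path G us \<Longrightarrow> length us \<le> length vs"
    by blast
  have nonempty: "vs \<noteq> []" using max[OF \<open>is_path G [v]\<close>] by auto
  have "set vs = verts G"
  proof (rule conn)
    show "set vs \<subseteq> verts G" using p by (simp add: is_path_def)
    show "set vs \<noteq> {}" using nonempty by simp
    fix u z assume u: "u \<in> set vs" and a: "adj G u z"
    show "z \<in> set vs"
    proof (rule ccontr)
      assume z: "z \<notin> set vs"
      have zV: "z \<in> verts G" using adj_distinct_verts[OF G(1) a] by simp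
      obtain i where i: "i < length vs" "u = vs ! i" using u by (auto simp: in_set_conv_nth)
      consider "i = 0" | "i = length vs - 1" | "0 < i" "Suc i < length vs" using i by linarith
      then show False
      proof cases
        case 1
        then have "is_path G (z # vs)"
          using a i by (intro is_path_Cons[OF p nonempty zV z]) (simp add: adj_sym)
        then show False using max by fastforce
      next
        case 2
        then have "is_path G (vs @ [z])"
          using a i by (intro is_path_snoc[OF p zV z]) simp
        then show False using max by fastforce
      next
        case 3
        then have "z = vs ! (i - 1) \<or> z = vs ! Suc i"
          using path_inner_neighbours[OF G p, of i z] a i by simp
        then show False using z 3 by auto
      qed
    qed
  qed
  then show thesis using that p nonempty by blast
qed

text \<open>The partition is given by the gauge phases. All adjacencies lie along the path, so every
  edge has type (j, j) and stays, while every arc has type (j, \<open>cnj omega\<close> j) and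
  becomes an edge. No arc has to be reversed.\<close>

lemma chordless_path_switching:
  assumes G: "mixed_graph G" and p: "is_path G vs" and V: "set vs = verts G"
    and chordless: "\<And>i j. i < j \<Longrightarrow> j < length vs \<Longrightarrow> adj G (vs ! i) (vs ! j) \<Longrightarrow> j = Suc i"
  shows "switching_equivalent G (path_mg (length vs))"
proof -
  let ?n = "length vs"
  have bij: "bij_betw ((!) vs) {..<?n} (verts G)"
    using p V by (auto simp: is_path_def bij_betw_nth)
  define h where "h = inv_into {..<?n} ((!) vs)"
  have hbij: "bij_betw h (verts G) {..<?n}" unfolding h_def by (rule bij_betw_inv_into[OF bij])
  have h: "h v < ?n" "vs ! h v = v" if "v \<in> verts G" for v
    using that bij_betwE[OF hbij] bij_betw_inv_into_right[OF bij that] by (auto simp: h_def)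
  have hn: "h (vs ! i) = i" if "i < ?n" for i
    using that bij_betw_inv_into_left[OF bij] by (simp add: h_def)
  have adj_h: "h v = Suc (h u) \<or> h u = Suc (h v)" if "adj G u v" for u v
  proof -
    have uv: "u \<noteq> v" "u \<in> verts G" "v \<in> verts G" using adj_distinct_verts[OF G that] by auto
    then have "h u \<noteq> h v" using h by metis
    then show ?thesis
      using chordless[of "h u" "h v"] chordless[of "h v" "h u"] h uv that adj_sym[of G u v]
      by (cases "h u < h v") auto
  qed
  define f where "f v = gauge G vs (h v)" for v
  have fT: "f v \<in> T6" if "v \<in> verts G" for v
    using that h gauge_T6[OF p] by (simp add: f_def)
  have step: "f v = f u * cnj (Nmat G u v)" if "h v = Suc (h u)" "u \<in> verts G" "v \<in> verts G" for u v
  proof -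
    have "vs ! Suc (h u) = v" using h(2)[OF that(3)] that(1) by simp
    then show ?thesis using h(2)[OF that(2)] by (simp add: f_def gauge_def that(1))
  qed
  have f: "f v = f u * cnj (Nmat G u v)" if a: "adj G u v" for u v
  proof -
    have uv: "u \<in> verts G" "v \<in> verts G" using adj_distinct_verts[OF G a] by auto
    from adj_h[OF a] show ?thesis
    proof
      assume "h u = Suc (h v)"
      then have "f u * cnj (Nmat G u v) = f v * (Nmat G u v * cnj (Nmat G u v))"
        using step[of u v] uv Nmat_hermitian[OF G, of v u] by simp
      then show ?thesis using T6_cancel[OF Nmat_T6[OF a]] by simp
    qed (use step uv in auto)
  qed
  have arc: "f v = cnj omega * f u" if "(u, v) \<in> arcs G" for u v
    using f[of u v] that by (simp add: adj_def Nmat_def)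
  have edge: "f v = f u" if "{u, v} \<in> edges G" for u v
  proof -
    have "(u, v) \<notin> arcs G" "(v, u) \<notin> arcs G"
      using G that unfolding mixed_graph_def by (auto simp: insert_commute)
    then show ?thesis using f[of u v] that by (simp add: adj_def Nmat_def)
  qed
  have adm: "admissible G f"
    unfolding admissible_def using fT edge arc by auto
  have nz: "f v \<noteq> 0" if "v \<in> verts G" for v
    using T6_norm[OF fT[OF that]] by auto
  let ?H = "three_way_switch G f"
  have "arcs ?H = {}"
  proof -
    have "(u, v) \<notin> arcs ?H" for u v
    proof
      assume a: "(u, v) \<in> arcs ?H"
      then have "adj G u v" by (auto simp: three_way_switch_def adj_def insert_commute)
      then have uv: "u \<in> verts G" "v \<in> verts G" using adj_distinct_verts[OF G] by auto
      from a consider "(u, v) \<in> arcs G" "f v = f u" | "{u, v} \<in> edges G" "f v = omega * f u"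
        | "(v, u) \<in> arcs G" "f u = - omega * f v"
        by (auto simp: three_way_switch_def)
      then show False
      proof cases
        case 1
        then have "cnj omega * f u = 1 * f u" using arc by simp
        then show False using nz uv omega_distinct by (metis mult_right_cancel)
      next
        case 2
        then have "omega * f u = 1 * f u" using edge by simp
        then show False using nz uv omega_distinct by (metis mult_right_cancel)
      next
        case 3
        then have "cnj omega * f v = - omega * f v" using arc by metis
        then show False using nz uv omega_distinct by (metis mult_right_cancel)
      qed
    qed
    then show ?thesis by auto
  qed
  moreover have edges: "edges ?H = {{u, v} | u v. adj G u v}"
  proof
    show "edges ?H \<subseteq> {{u, v} | u v. adj G u v}"
      by (auto simp: three_way_switch_def adj_def)
    show "{{u, v} | u v. adj G u v} \<subseteq> edges ?H"
    proof
      fix e assume "e \<in> {{u, v} | u v. adj G u v}"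
      then obtain u v where uv: "e = {u, v}" "adj G u v" by blast
      then consider "{u, v} \<in> edges G" | "(u, v) \<in> arcs G" | "(v, u) \<in> arcs G"
        by (auto simp: adj_def)
      then show "e \<in> edges ?H"
      proof cases
        case 1
        then show ?thesis using edge[of u v] uv(1) unfolding three_way_switch_def by auto
      next
        case 2
        then show ?thesis using arc[of u v] uv(1) unfolding three_way_switch_def by auto
      next
        case 3
        moreover have "e = {v, u}" using uv(1) by auto
        ultimately show ?thesis using arc[of v u] unfolding three_way_switch_def by auto
      qed
    qed
  qed
  moreover have "edges (path_mg ?n) = (`) h ` {{u, v} | u v. adj G u v}"
  proof
    show "edges (path_mg ?n) \<subseteq> (`) h ` {{u, v} | u v. adj G u v}"
    proof
      fix e assume "e \<in> edges (path_mg ?n)"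
      then obtain i where i: "e = {i, Suc i}" "Suc i < ?n" by (auto simp: path_mg_def)
      then have "e = h ` {vs ! i, vs ! Suc i}" "adj G (vs ! i) (vs ! Suc i)"
        using hn is_path_adj[OF p] by auto
      then show "e \<in> (`) h ` {{u, v} | u v. adj G u v}" by blast
    qed
    show "(`) h ` {{u, v} | u v. adj G u v} \<subseteq> edges (path_mg ?n)"
    proof
      fix e assume "e \<in> (`) h ` {{u, v} | u v. adj G u v}"
      then obtain u v where uv: "e = {h u, h v}" "adj G u v" by auto
      moreover have "h u < ?n" "h v < ?n" using h adj_distinct_verts[OF G uv(2)] by auto
      ultimately show "e \<in> edges (path_mg ?n)"
        using adj_h[OF uv(2)] by (auto simp: path_mg_def insert_commute)
    qed
  qed
  moreover have "verts ?H = verts G" by (simp add: three_way_switch_def)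
  moreover have "verts (path_mg ?n) = {..<?n}" "arcs (path_mg ?n) = {}"
    by (auto simp: path_mg_def)
  ultimately have "mg_iso ?H (path_mg ?n)"
    unfolding mg_iso_def using hbij by (intro exI[of _ h]) simp
  moreover have "switch_step G ?H" unfolding switch_step_def using adm by blast
  ultimately show ?thesis unfolding switching_equivalent_def by blast
qed

text \<open>Three arcs, one edge and two nonadjacent diagonals account for all six pairs of
  vertices, which determines \<open>arcs G\<close> and \<open>edges G\<close>.\<close>

lemma mg_iso_C4eq:
  assumes G: "mixed_graph G" and V: "verts G = {a, b, c, d}" and dist: "distinct [a, b, c, d]"
    and na: "\<not> adj G a c" "\<not> adj G b d"
    and A: "(a, b) \<in> arcs G" "(b, c) \<in> arcs G" "(c, d) \<in> arcs G" and E: "{d, a} \<in> edges G"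
  shows "mg_iso G C4eq"
proof -
  have no: "(v, u) \<notin> arcs G" "{u, v} \<notin> edges G" if "(u, v) \<in> arcs G" for u v
    using that G unfolding mixed_graph_def by auto
  have noE: "(d, a) \<notin> arcs G" "(a, d) \<notin> arcs G"
    using no[of d a] no[of a d] E by (auto simp: insert_commute)
  have na': "\<not> adj G c a" "\<not> adj G d b" using na by (simp_all add: adj_sym)
  have arcs: "arcs G = {(a, b), (b, c), (c, d)}"
  proof
    show "arcs G \<subseteq> {(a, b), (b, c), (c, d)}"
    proof
      fix e assume e: "e \<in> arcs G"
      obtain u v where uv: "e = (u, v)" by (cases e)
      then have "adj G u v" using e by (auto simp: adj_def)
      then have "u \<noteq> v" "u \<in> {a, b, c, d}" "v \<in> {a, b, c, d}"
        using adj_distinct_verts[OF G] V by auto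
      then show "e \<in> {(a, b), (b, c), (c, d)}"
        using e uv \<open>adj G u v\<close> na na' noE no(1)[OF A(1)] no(1)[OF A(2)] no(1)[OF A(3)]
        by (elim insertE emptyE) simp_all
    qed
  qed (use A in auto)
  have edges: "edges G = {{d, a}}"
  proof
    show "edges G \<subseteq> {{d, a}}"
    proof
      fix e assume e: "e \<in> edges G"
      obtain u v where uv: "e = {u, v}" "adj G u v" using edges_adjE[OF G e] by blast
      then have "u \<noteq> v" "u \<in> {a, b, c, d}" "v \<in> {a, b, c, d}"
        using adj_distinct_verts[OF G] V by auto
      then show "e \<in> {{d, a}}"
        using e uv na na' no(2)[OF A(1)] no(2)[OF A(2)] no(2)[OF A(3)]
        by (elim insertE emptyE) (simp_all add: insert_commute)
    qed
  qed (use E in auto)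
  define h :: "'a \<Rightarrow> nat" where
    "h v = (if v = a then 0 else if v = b then 1 else if v = c then 2 else 3)" for v
  have h: "h a = 0" "h b = 1" "h c = 2" "h d = 3" using dist by (auto simp: h_def)
  have "bij_betw h (verts G) (verts C4eq)"
    unfolding V C4eq_def bij_betw_def using h dist by (auto simp: inj_on_def)
  then show ?thesis
    unfolding mg_iso_def by (intro exI[of _ h]) (simp add: arcs edges h C4eq_def)
qed

text \<open>Written as powers of omega, the factors have exponents 0, 1 or -1, and these sum to 3
  modulo 6. A sum of four lies between -4 and 4, so it is 3 or -3: three exponents agree and the
  fourth is 0.\<close>

lemma unit_weights_product:
  assumes "p \<in> {1, omega, cnj omega}" "q \<in> {1, omega, cnj omega}"
    and "r \<in> {1, omega, cnj omega}" "s \<in> {1, omega, cnj omega}"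
    and "p * q * r * s = -1"
  obtains t where "t = omega \<or> t = cnj omega"
    "p = 1 \<and> q = t \<and> r = t \<and> s = t \<or> p = t \<and> q = 1 \<and> r = t \<and> s = t \<or>
     p = t \<and> q = t \<and> r = 1 \<and> s = t \<or> p = t \<and> q = t \<and> r = t \<and> s = 1"
proof -
  have "cnj omega \<noteq> -1" "omega \<noteq> cnj omega" "cnj omega \<noteq> omega"
    by (simp_all add: omega_def complex_eq_iff)
  moreover have "omega * x = - 1 \<longleftrightarrow> x = - cnj omega" "cnj omega * x = - 1 \<longleftrightarrow> x = - omega" for x
    by (metis (no_types, lifting) omega_sixth_root(2,3) mult.assoc mult.left_neutral mult_minus_right
        mult.right_neutral)+
  ultimately show thesis
    using assms that[of omega] that[of "cnj omega"] omega_distinct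
    by (elim insertE emptyE) (simp_all add: omega_square omega_sixth_root(2,3))
qed

lemma Nmat_values:
  assumes "mixed_graph G" "adj G u v"
  shows "Nmat G u v \<in> {1, omega, cnj omega}"
    "Nmat G u v = omega \<longleftrightarrow> (u, v) \<in> arcs G" "Nmat G u v = cnj omega \<longleftrightarrow> (v, u) \<in> arcs G"
    "Nmat G u v = 1 \<longleftrightarrow> {u, v} \<in> edges G"
proof -
  have "(u, v) \<in> arcs G \<Longrightarrow> (v, u) \<notin> arcs G \<and> {u, v} \<notin> edges G"
    "(v, u) \<in> arcs G \<Longrightarrow> {u, v} \<notin> edges G"
    using assms(1) unfolding mixed_graph_def by (auto simp: insert_commute)
  then show "Nmat G u v \<in> {1, omega, cnj omega}"
    "Nmat G u v = omega \<longleftrightarrow> (u, v) \<in> arcs G" "Nmat G u v = cnj omega \<longleftrightarrow> (v, u) \<in> arcs G"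
    "Nmat G u v = 1 \<longleftrightarrow> {u, v} \<in> edges G"
    using assms(2) omega_distinct omega_distinct(2)[symmetric] omega_distinct(1)[symmetric]
    by (auto simp: Nmat_def adj_def)
qed

text \<open>The eight instances in \<open>iso\<close> are the four rotations in both directions. The
  rotation moves the undirected edge to the end; for t = \<open>cnj omega\<close> the arcs run
  against the listed order, and the cycle is read backwards.\<close>

lemma four_cycle_iso:
  assumes G: "mixed_graph G" and V: "verts G = {a, b, c, d}" and dist: "distinct [a, b, c, d]"
    and na: "\<not> adj G a c" "\<not> adj G b d"
    and ad: "adj G a b" "adj G b c" "adj G c d" "adj G d a"
    and w: "Nmat G a b * Nmat G b c * Nmat G c d * Nmat G d a = -1"
  shows "mg_iso G C4eq"
proof -
  note N = Nmat_values[OF G ad(1)] Nmat_values[OF G ad(2)] Nmat_values[OF G ad(3)]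
    Nmat_values[OF G ad(4)]
  have na': "\<not> adj G c a" "\<not> adj G d b" using na by (simp_all add: adj_sym)
  have V': "verts G = {b, c, d, a}" "verts G = {c, d, a, b}" "verts G = {d, a, b, c}"
    "verts G = {d, c, b, a}" "verts G = {c, b, a, d}" "verts G = {b, a, d, c}" "verts G = {a, d, c, b}"
    using V by auto
  have D: "distinct [b, c, d, a]" "distinct [c, d, a, b]" "distinct [d, a, b, c]"
    "distinct [d, c, b, a]" "distinct [c, b, a, d]" "distinct [b, a, d, c]" "distinct [a, d, c, b]"
    using dist by auto
  note iso = mg_iso_C4eq[OF G V dist na] mg_iso_C4eq[OF G V'(1) D(1) na(2) na'(1)]
    mg_iso_C4eq[OF G V'(2) D(2) na'] mg_iso_C4eq[OF G V'(3) D(3) na'(2) na(1)]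
    mg_iso_C4eq[OF G V'(4) D(4) na'(2,1)] mg_iso_C4eq[OF G V'(5) D(5) na'(1) na(2)]
    mg_iso_C4eq[OF G V'(6) D(6) na(2,1)] mg_iso_C4eq[OF G V'(7) D(7) na(1) na'(2)]
  obtain t where t: "t = omega \<or> t = cnj omega"
    "Nmat G a b = 1 \<and> Nmat G b c = t \<and> Nmat G c d = t \<and> Nmat G d a = t \<or>
     Nmat G a b = t \<and> Nmat G b c = 1 \<and> Nmat G c d = t \<and> Nmat G d a = t \<or>
     Nmat G a b = t \<and> Nmat G b c = t \<and> Nmat G c d = 1 \<and> Nmat G d a = t \<or>
     Nmat G a b = t \<and> Nmat G b c = t \<and> Nmat G c d = t \<and> Nmat G d a = 1"
    by (rule unit_weights_product[OF N(1) N(5) N(9) N(13) w])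
  from t show ?thesis
    by (elim disjE conjE; simp only: N(2-4) N(6-8) N(10-12) N(14-16))
      (erule (3) iso | (rule iso; simp add: insert_commute))+
qed

lemma subcritical_connected:
  assumes G: "mixed_graph G" "subcritical G" and ne: "verts G \<noteq> {}"
    and conn: "\<And>S. S \<subseteq> verts G \<Longrightarrow> S \<noteq> {} \<Longrightarrow> (\<And>u v. u \<in> S \<Longrightarrow> adj G u v \<Longrightarrow> v \<in> S) \<Longrightarrow> S = verts G"
  shows "(\<exists>k\<in>{1, 2, 3, 4}. switching_equivalent G (path_mg k)) \<or> switching_equivalent G C4eq"
proof -
  obtain vs where p: "is_path G vs" and V: "set vs = verts G" and nonempty: "vs \<noteq> []"
    using spanning_path[OF assms] by blast
  have "length vs \<noteq> 0" "length vs \<le> 4" using nonempty is_path_length_le_4[OF G p] by auto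
  then have "length vs = 1 \<or> length vs = 2 \<or> length vs = 3 \<or> length vs = 4" by linarith
  then have l: "length vs \<in> {1, 2, 3, 4}" by simp
  show ?thesis
  proof (cases "\<forall>i j. i < j \<longrightarrow> j < length vs \<longrightarrow> adj G (vs ! i) (vs ! j) \<longrightarrow> j = Suc i")
    case True
    then show ?thesis using chordless_path_switching[OF G(1) p V] l by blast
  next
    case False
    then obtain i j where ij: "i < j" "j < length vs" "adj G (vs ! i) (vs ! j)" "j \<noteq> Suc i" by blast
    then have e: "i = 0" "Suc j = length vs" using path_chord[OF G p, of i j] by auto
    have "length vs \<noteq> 3"
      using no_triangle[OF G p] ij e by auto
    then have l4: "length vs = 4" and a03: "adj G (vs ! 0) (vs ! 3)" using ij e l by auto
    obtain a b c d where vs: "vs = [a, b, c, d]"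
      using l4 by (auto simp: numeral_eq_Suc length_Suc_conv)
    have "gauged G vs 0 3 = -1" by (rule four_cycle_weight[OF G p l4 a03])
    then have "Nmat G a d * cnj (Nmat G a b * Nmat G b c * Nmat G c d) = -1"
      by (simp add: gauged_def gauge_def vs numeral_eq_Suc mult_ac)
    \<comment> \<open>The gauged corner is the conjugate of the cycle weight; since -1 is real,
      conjugation turns the equation into one for the weight.\<close>
    then have "cnj (Nmat G a d * cnj (Nmat G a b * Nmat G b c * Nmat G c d)) = -1" by simp
    then have w: "Nmat G a b * Nmat G b c * Nmat G c d * Nmat G d a = -1"
      using Nmat_hermitian[OF G(1), of d a] by (simp add: mult_ac)
    have "\<not> adj G a c"
      using path_chord[OF G p, of 0 2] unfolding vs by auto
    moreover have "\<not> adj G b d"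
      using path_chord[OF G p, of 1 3] unfolding vs by auto
    moreover have "adj G a b" "adj G b c" "adj G c d"
      using is_path_adj[OF p, of 0] is_path_adj[OF p, of 1] is_path_adj[OF p, of 2]
      unfolding vs by simp_all
    moreover have "adj G d a" using a03 unfolding vs adj_sym[of G d a] by simp
    moreover have "verts G = {a, b, c, d}" "distinct [a, b, c, d]"
      using p V by (auto simp: vs is_path_def)
    ultimately have "mg_iso G C4eq" using four_cycle_iso[OF G(1)] w by blast
    \<comment> \<open>The graph is already isomorphic to \<open>C4eq\<close>, so the empty sequence
      of switchings suffices.\<close>
    then show ?thesis unfolding switching_equivalent_def by blast
  qed
qed

section \<open>Components\<close>

lemma adj_rtranclp_sym: "(adj G)\<^sup>*\<^sup>* u v \<Longrightarrow> (adj G)\<^sup>*\<^sup>* v u"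
  by (metis adj_sym symp_rtranclp sympD sympI)

lemma component_connected:
  assumes G: "mixed_graph G" and C: "C \<in> components G"
    and S: "S \<subseteq> C" "S \<noteq> {}" "\<And>u v. u \<in> S \<Longrightarrow> adj (induced G C) u v \<Longrightarrow> v \<in> S"
  shows "S = C"
proof
  obtain u where u: "C = {v \<in> verts G. (adj G)\<^sup>*\<^sup>* u v}" using C unfolding components_def by blast
  obtain s where s: "s \<in> S" using S(2) by blast
  show "C \<subseteq> S"
  proof
    fix c assume "c \<in> C"
    then have "(adj G)\<^sup>*\<^sup>* s c"
      using s S(1) u adj_rtranclp_sym[of G u s] by (auto intro: rtranclp_trans)
    then show "c \<in> S"
    proof (induction rule: rtranclp_induct)
      case (step y z)
      then have "y \<in> C" using S(1) by blast
      moreover have "z \<in> C"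
        using \<open>y \<in> C\<close> step(2) adj_distinct_verts[OF G step(2)] u by (auto intro: rtranclp.rtrancl_into_rtrancl)
      ultimately show ?case using S(3)[OF step(3)] step(2) by (simp add: adj_induced)
    qed (rule s)
  qed
qed (rule S(1))

lemma component_closed:
  assumes "mixed_graph G" "C \<in> components G" "u \<in> C" "adj G u v"
  shows "v \<in> C"
  using assms(2,3,4) adj_distinct_verts[OF assms(1,4)] unfolding components_def
  by (auto intro: rtranclp.rtrancl_into_rtrancl)

text \<open>N is block diagonal over the components, so an eigenvector restricted to a component on
  which it does not vanish is still an eigenvector.\<close>

lemma eigenvalue_induced_component:
  assumes G: "mixed_graph G" and l: "is_eigenvalue G l"
  obtains C where "C \<in> components G" "is_eigenvalue (induced G C) l"
proof -
  obtain x v where x: "v \<in> verts G" "x v \<noteq> 0"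
    "\<And>u. u \<in> verts G \<Longrightarrow> (\<Sum>w\<in>verts G. Nmat G u w * x w) = l * x u"
    using l unfolding is_eigenvalue_def by blast
  define C where "C = {w \<in> verts G. (adj G)\<^sup>*\<^sup>* v w}"
  have C: "C \<in> components G" using x(1) unfolding components_def C_def by blast
  have CV: "C \<subseteq> verts G" by (auto simp: C_def)
  have "(\<Sum>w\<in>C. Nmat (induced G C) u w * x w) = l * x u" if u: "u \<in> C" for u
  proof -
    have "(\<Sum>w\<in>C. Nmat (induced G C) u w * x w) = (\<Sum>w\<in>C. Nmat G u w * x w)"
      using u by (simp add: Nmat_induced)
    also have "\<dots> = (\<Sum>w\<in>verts G. Nmat G u w * x w)"
    proof (rule sum.mono_neutral_left)
      show "\<forall>w\<in>verts G - C. Nmat G u w * x w = 0"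
        using component_closed[OF G C u] by (auto simp: Nmat_eq_0_iff)
    qed (use G CV in \<open>auto simp: mixed_graph_def\<close>)
    finally show ?thesis using x(3) u CV by auto
  qed
  moreover have "v \<in> C" using x(1) by (simp add: C_def)
  ultimately have "is_eigenvalue (induced G C) l"
    unfolding is_eigenvalue_def verts_induced using x(2) by blast
  with C show thesis by (rule that)
qed

theorem theorem6p5:
  fixes G :: "'a mgraph"
  assumes "mixed_graph G" and "verts G \<noteq> {}"
  shows "spectral_radius G < sqrt 3 \<longleftrightarrow>
    (\<forall>C\<in>components G.
       switching_equivalent (induced G C) (path_mg 1) \<or>
       switching_equivalent (induced G C) (path_mg 2) \<or>
       switching_equivalent (induced G C) (path_mg 3) \<or>
       switching_equivalent (induced G C) (path_mg 4) \<or>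
       switching_equivalent (induced G C) C4eq)"
  unfolding spectral_radius_less_sqrt3_iff[OF assms]
proof
  have fin: "finite (verts G)" using assms(1) by (simp add: mixed_graph_def)
  have sub: "C \<subseteq> verts G" if "C \<in> components G" for C
    using that by (auto simp: components_def)
  show "\<forall>C\<in>components G.
       switching_equivalent (induced G C) (path_mg 1) \<or>
       switching_equivalent (induced G C) (path_mg 2) \<or>
       switching_equivalent (induced G C) (path_mg 3) \<or>
       switching_equivalent (induced G C) (path_mg 4) \<or>
       switching_equivalent (induced G C) C4eq"
    if "\<forall>l. is_eigenvalue G l \<longrightarrow> cmod l < sqrt 3"
  proof
    fix C assume C: "C \<in> components G"
    have "subcritical G" using subcritical_if_eigenvalues[OF assms] that by blast
    then have "subcritical (induced G C)" by (rule subcritical_induced[OF fin _ sub[OF C]])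
    moreover have "verts (induced G C) \<noteq> {}" using C by (auto simp: components_def verts_induced)
    ultimately have "(\<exists>k\<in>{1, 2, 3, 4}. switching_equivalent (induced G C) (path_mg k)) \<or>
        switching_equivalent (induced G C) C4eq"
      using component_connected[OF assms(1) C] mixed_graph_induced[OF assms(1) sub[OF C]]
      by (intro subcritical_connected) (auto simp: verts_induced)
    then show "switching_equivalent (induced G C) (path_mg 1) \<or>
       switching_equivalent (induced G C) (path_mg 2) \<or>
       switching_equivalent (induced G C) (path_mg 3) \<or>
       switching_equivalent (induced G C) (path_mg 4) \<or>
       switching_equivalent (induced G C) C4eq" by blast
  qed
  show "\<forall>l. is_eigenvalue G l \<longrightarrow> cmod l < sqrt 3"
    if eq: "\<forall>C\<in>components G.
       switching_equivalent (induced G C) (path_mg 1) \<or>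
       switching_equivalent (induced G C) (path_mg 2) \<or>
       switching_equivalent (induced G C) (path_mg 3) \<or>
       switching_equivalent (induced G C) (path_mg 4) \<or>
       switching_equivalent (induced G C) C4eq"
  proof (intro allI impI)
    fix l assume "is_eigenvalue G l"
    \<comment> \<open>Localising the eigenvalue in one component avoids assembling the form bound
      for the whole graph from those of the components.\<close>
    then obtain C where C: "C \<in> components G" "is_eigenvalue (induced G C) l"
      by (rule eigenvalue_induced_component[OF assms(1)])
    note H = mixed_graph_induced[OF assms(1) sub[OF C(1)]]
    have k: "switching_equivalent (induced G C) (path_mg k) \<Longrightarrow> k \<le> 4 \<Longrightarrow> subcritical (induced G C)" for k
      using subcritical_switching_equivalent[OF H mixed_graph_path] subcritical_path by blast
    have "switching_equivalent (induced G C) C4eq \<Longrightarrow> subcritical (induced G C)"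
      using subcritical_switching_equivalent[OF H mixed_graph_C4eq] subcritical_C4eq by blast
    then have "subcritical (induced G C)"
      using eq C(1) k[of 1] k[of 2] k[of 3] k[of 4] by auto
    then show "cmod l < sqrt 3"
      using subcritical_eigenvalue C(2) H by (auto simp: mixed_graph_def)
  qed
qed

end
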